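(* For every even integer $n\ge 42$ there exists a nontrivial snark of order $n$ (i.e. with $n$ vertices) with perfect matching index at least $5$.
   Context: A snark is a 2-connected cubic graph that has no proper $3$-edge-colouring. A snark is nontrivial if it is cyclically $4$-edge-connected (no set of fewer than four edges whose removal leaves at least two components containing cycles) and has girth at least $5$. The perfect matching index $\pi(G)$ of a bridgeless cubic graph $G$ is the minimum number of perfect matchings whose union is $E(G)$; thus $\pi(G)\ge 5$ means that $E(G)$ is not a union of four (not necessarily distinct) perfect matchings. *)

theory Defs
  imports Main "HOL-Library.Extended_Nat"
begin

text \<open>
  A finite simple graph is given by a vertex set \<open>V\<close> and a set \<open>E\<close> of two-element subsets of \<open>V\<close>.
  Loops and parallel edges are cycles of length 1 and 2, so every cubic graph of girth at least 5
  is of this form.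
\<close>

definition simple_graph :: "'a set \<Rightarrow> 'a set set \<Rightarrow> bool" where
  "simple_graph V E \<longleftrightarrow> finite V \<and> (\<forall>e\<in>E. e \<subseteq> V \<and> card e = 2)"

definition cubic :: "'a set \<Rightarrow> 'a set set \<Rightarrow> bool" where
  "cubic V E \<longleftrightarrow> (\<forall>v\<in>V. card {e \<in> E. v \<in> e} = 3)"

definition adj :: "'a set set \<Rightarrow> ('a \<times> 'a) set" where
  "adj E = {(u, v). {u, v} \<in> E}"

definition graph_connected :: "'a set \<Rightarrow> 'a set set \<Rightarrow> bool" where
  "graph_connected V E \<longleftrightarrow> V \<noteq> {} \<and> (\<forall>u\<in>V. \<forall>v\<in>V. (u, v) \<in> (adj E)\<^sup>*)"

definition two_connected :: "'a set \<Rightarrow> 'a set set \<Rightarrow> bool" where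
  "two_connected V E \<longleftrightarrow>
     card V \<ge> 3 \<and> graph_connected V E \<and>
     (\<forall>v\<in>V. graph_connected (V - {v}) {e \<in> E. v \<notin> e})"

definition proper_edge_colouring :: "nat \<Rightarrow> 'a set set \<Rightarrow> ('a set \<Rightarrow> nat) \<Rightarrow> bool" where
  "proper_edge_colouring k E c \<longleftrightarrow>
     (\<forall>e\<in>E. c e < k) \<and>
     (\<forall>e\<in>E. \<forall>f\<in>E. e \<noteq> f \<and> e \<inter> f \<noteq> {} \<longrightarrow> c e \<noteq> c f)"

definition snark :: "'a set \<Rightarrow> 'a set set \<Rightarrow> bool" where
  "snark V E \<longleftrightarrow>
     simple_graph V E \<and> cubic V E \<and> two_connected V E \<and>
     \<not> (\<exists>c. proper_edge_colouring 3 E c)"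

definition graph_cycle :: "'a set set \<Rightarrow> 'a list \<Rightarrow> bool" where
  "graph_cycle E p \<longleftrightarrow>
     length p \<ge> 3 \<and> distinct p \<and>
     (\<forall>i<length p. {p ! i, p ! (Suc i mod length p)} \<in> E)"

text \<open>The girth of a forest is \<open>\<infinity>\<close>.\<close>

definition girth :: "'a set set \<Rightarrow> enat" where
  "girth E = (INF p\<in>{p. graph_cycle E p}. enat (length p))"

definition components :: "'a set \<Rightarrow> 'a set set \<Rightarrow> 'a set set" where
  "components V E = {{w \<in> V. (v, w) \<in> (adj E)\<^sup>*} | v. v \<in> V}"

definition contains_cycle :: "'a set set \<Rightarrow> 'a set \<Rightarrow> bool" where
  "contains_cycle E C \<longleftrightarrow> (\<exists>p. graph_cycle E p \<and> set p \<subseteq> C)"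

definition cyclically_edge_connected :: "nat \<Rightarrow> 'a set \<Rightarrow> 'a set set \<Rightarrow> bool" where
  "cyclically_edge_connected k V E \<longleftrightarrow>
     \<not> (\<exists>S\<subseteq>E. finite S \<and> card S < k \<and>
          (\<exists>C\<in>components V (E - S). \<exists>D\<in>components V (E - S).
             C \<noteq> D \<and> contains_cycle (E - S) C \<and> contains_cycle (E - S) D))"

definition nontrivial_snark :: "'a set \<Rightarrow> 'a set set \<Rightarrow> bool" where
  "nontrivial_snark V E \<longleftrightarrow>
     snark V E \<and> cyclically_edge_connected 4 V E \<and> girth E \<ge> 5"

definition perfect_matching :: "'a set \<Rightarrow> 'a set set \<Rightarrow> 'a set set \<Rightarrow> bool" where
  "perfect_matching V E M \<longleftrightarrow> M \<subseteq> E \<and> (\<forall>v\<in>V. \<exists>!e. e \<in> M \<and> v \<in> e)"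

text \<open>
  The minimum is taken in \<^typ>\<open>enat\<close>, with value \<open>\<infinity>\<close> if \<open>E\<close> is not a union of perfect matchings;
  this does not happen for bridgeless cubic graphs.
\<close>

definition perfect_matching_index :: "'a set \<Rightarrow> 'a set set \<Rightarrow> enat" where
  "perfect_matching_index V E =
     (INF \<M>\<in>{\<M>. finite \<M> \<and> (\<forall>M\<in>\<M>. perfect_matching V E M) \<and> \<Union>\<M> = E}. enat (card \<M>))"

end

theory Submission
  imports Defs
begin

text \<open>
  A cover of a cubic graph by four perfect matchings labels every edge by the set of matchings that
  contain it: at each vertex the labels partition a four-element set, so they have sizes 1, 1, 2,
  and the edges with a label of size 2 (double edges) form a perfect matching.

  Removing two adjacent vertices from the Petersen graph leaves a 4-pole whose boundary labels are
  severely restricted. Three such 4-poles and seven further vertices give a 5-pole (the windmill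
  snark of order 34 minus a path on three vertices) in which no labelling has exactly one more double
  edge among four of its dangling edges than on the fifth. If the rest of the graph is
  bipartite, with the ends of these four edges in one colour class and that of the fifth
  in the other, then counting double edges forces exactly that difference, so four perfect matchings
  do not suffice. The bipartite part is a strip with chords of length 5 (the cubic graph with LCF
  code \<open>[5, -5]\<^sup>m\<close> minus a path on three vertices), which exists in all odd orders from 11 on.

  In a cubic graph, cyclic 4-edge-connectivity follows from a bound on all edge cuts. For the
  windmill this bound is propagated through a sequence of edge insertions starting at \<open>K\<^sub>4\<close>; for the
  strip it is checked on intervals; cuts meeting both parts split into a cut of each.
\<close>

section \<open>Edge cuts\<close>

definition edge_cut :: "'a set set \<Rightarrow> 'a set \<Rightarrow> 'a set set" where
  "edge_cut E A = {e \<in> E. e \<inter> A \<noteq> {} \<and> \<not> e \<subseteq> A}"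

text \<open>Phrased with vertex sets instead of cycles: such a bound can be followed through edge
  insertions and gluing, and it yields both 2-connectivity and cyclic 4-edge-connectivity.\<close>

definition essentially_4_edge_connected :: "'a set \<Rightarrow> 'a set set \<Rightarrow> bool" where
  "essentially_4_edge_connected V E \<longleftrightarrow> (\<forall>A\<subseteq>V. A \<noteq> {} \<longrightarrow> A \<noteq> V \<longrightarrow> 3 \<le> card (edge_cut E A) \<and>
     (2 \<le> card A \<longrightarrow> 2 \<le> card (V - A) \<longrightarrow> 4 \<le> card (edge_cut E A)))"

lemma simple_graph_finite_edges: "simple_graph V E \<Longrightarrow> finite E"
  unfolding simple_graph_def by (meson PowI finite_Pow_iff finite_subset subsetI)

lemma simple_graph_edgeE:
  assumes "simple_graph V E" "e \<in> E"
  obtains x y where "e = {x, y}" "x \<noteq> y" "x \<in> V" "y \<in> V"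
  using assms unfolding simple_graph_def by (metis card_2_iff insert_subset)

lemma simple_graph_subset: "simple_graph V E \<Longrightarrow> F \<subseteq> E \<Longrightarrow> simple_graph V F"
  unfolding simple_graph_def by auto

lemma finite_cut: "finite E \<Longrightarrow> finite (edge_cut E A)"
  unfolding edge_cut_def by simp

lemma cut_complement:
  assumes "simple_graph V E" "A \<subseteq> V"
  shows "edge_cut E (V - A) = edge_cut E A"
  using assms unfolding edge_cut_def simple_graph_def by blast

lemma sym_adj: "sym (adj E)"
  unfolding sym_def adj_def by (simp add: insert_commute)

text \<open>An edge leaving the reachable set would make its other end reachable.\<close>

lemma cut_reachable:
  assumes "simple_graph V F"
  shows "edge_cut F {w \<in> V. (u, w) \<in> (adj F)\<^sup>*} = {}"
proof -
  have False if e: "e \<in> F" "x \<in> e" "x \<in> V" "(u, x) \<in> (adj F)\<^sup>*" "y \<in> e" "(u, y) \<notin> (adj F)\<^sup>*" for e x y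
  proof -
    obtain a b where "e = {a, b}" using simple_graph_edgeE[OF assms e(1)] by metis
    then have "e = {x, y}" using e by blast
    then have "(x, y) \<in> adj F" using e(1) unfolding adj_def by simp
    then show False using e(4,6) by (meson rtrancl.rtrancl_into_rtrancl)
  qed
  then show ?thesis using assms unfolding edge_cut_def simple_graph_def by blast
qed

lemma essentially_4_edge_connected_cut_ge_3: "essentially_4_edge_connected V E \<Longrightarrow> A \<subseteq> V \<Longrightarrow> A \<noteq> {} \<Longrightarrow> A \<noteq> V \<Longrightarrow> 3 \<le> card (edge_cut E A)"
  unfolding essentially_4_edge_connected_def by blast

lemma essentially_4_edge_connected_connected:
  assumes "simple_graph V E" "essentially_4_edge_connected V E" "V \<noteq> {}"
  shows "graph_connected V E"
  unfolding graph_connected_def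
proof (intro conjI ballI assms(3))
  fix u v assume uv: "u \<in> V" "v \<in> V"
  let ?K = "{w \<in> V. (u, w) \<in> (adj E)\<^sup>*}"
  have "?K = V"
  proof (rule ccontr)
    assume "?K \<noteq> V"
    then have "3 \<le> card (edge_cut E ?K)" using essentially_4_edge_connected_cut_ge_3[OF assms(2), of ?K] uv by blast
    then show False using cut_reachable[OF assms(1), of u] by simp
  qed
  then show "(u, v) \<in> (adj E)\<^sup>*" using uv by blast
qed

text \<open>If deleting \<open>v\<close> separated the graph into two sides, every edge leaving
  either side would end in \<open>v\<close>. The two cuts are disjoint and have at least three edges
  each, but \<open>v\<close> has degree 3.\<close>

lemma essentially_4_edge_connected_two_connected:
  assumes sg: "simple_graph V E" and cb: "cubic V E" and es: "essentially_4_edge_connected V E" and V3: "3 \<le> card V"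
  shows "two_connected V E"
  unfolding two_connected_def
proof (intro conjI ballI V3)
  show "graph_connected V E" using essentially_4_edge_connected_connected[OF sg es] V3 by fastforce
  fix v assume v: "v \<in> V"
  let ?V = "V - {v}" and ?F = "{e \<in> E. v \<notin> e}" and ?S = "{e \<in> E. v \<in> e}"
  have finV: "finite V" using sg unfolding simple_graph_def by simp
  have sgF: "simple_graph ?V ?F" using sg unfolding simple_graph_def by blast
  have S: "card ?S = 3" "finite ?S"
    using cb v simple_graph_finite_edges[OF sg] unfolding cubic_def by auto
  show "graph_connected ?V ?F"
    unfolding graph_connected_def
  proof (intro conjI ballI)
    have "card ?V = card V - 1" using v finV by simp
    then show "?V \<noteq> {}" using V3 by (metis card.empty diff_diff_cancel diff_zero le_trans not_numeral_le_zero one_le_numeral numeral_le_one_iff semiring_norm(70))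
    fix a b assume ab: "a \<in> ?V" "b \<in> ?V"
    show "(a, b) \<in> (adj ?F)\<^sup>*"
    proof (rule ccontr)
      assume nr: "(a, b) \<notin> (adj ?F)\<^sup>*"
      define K where "K = {w \<in> ?V. (a, w) \<in> (adj ?F)\<^sup>*}"
      define L where "L = ?V - K"
      have K: "K \<subseteq> ?V" and aK: "a \<in> K" and bL: "b \<in> L" using ab nr unfolding K_def L_def by auto
      have 0: "edge_cut ?F K = {}" unfolding K_def by (rule cut_reachable[OF sgF])
      have 1: "edge_cut ?F L = {}" unfolding L_def using cut_complement[OF sgF K] 0 by simp
      have c0: "edge_cut E K \<subseteq> ?S" using 0 unfolding edge_cut_def by blast
      have c1: "edge_cut E L \<subseteq> ?S" using 1 unfolding edge_cut_def by blast
      have gK: "3 \<le> card (edge_cut E K)"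
      proof (rule essentially_4_edge_connected_cut_ge_3[OF es])
        show "K \<subseteq> V" "K \<noteq> {}" "K \<noteq> V" using K aK v by blast+
      qed
      have gL: "3 \<le> card (edge_cut E L)"
      proof (rule essentially_4_edge_connected_cut_ge_3[OF es])
        show "L \<subseteq> V" "L \<noteq> {}" "L \<noteq> V" using bL v unfolding L_def by blast+
      qed
      have "edge_cut E K \<inter> edge_cut E L = {}"
      proof (rule equals0I)
        fix e assume e: "e \<in> edge_cut E K \<inter> edge_cut E L"
        then have "v \<in> e" "e \<in> E" using c0 unfolding edge_cut_def by auto
        then obtain w where "e = {v, w}" by (metis simple_graph_edgeE[OF sg] insertE insert_commute singletonD)
        moreover have "v \<notin> K" "v \<notin> L" using K unfolding L_def by auto
        ultimately have "w \<in> K" "w \<in> L" using e unfolding edge_cut_def by auto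
        then show False unfolding L_def by blast
      qed
      then have "card (edge_cut E K \<union> edge_cut E L) = card (edge_cut E K) + card (edge_cut E L)"
        using finite_subset[OF c0 S(2)] finite_subset[OF c1 S(2)] by (intro card_Un_disjoint)
      moreover have "card (edge_cut E K \<union> edge_cut E L) \<le> card ?S" using c0 c1 by (intro card_mono[OF S(2)]) blast
      ultimately show False using gK gL S(1) by linarith
    qed
  qed
qed

text \<open>All edges of \<open>E\<close> leaving a component of \<open>E - S\<close> lie in
  \<open>S\<close>. If two components contain cycles, then the first and its complement have at
  least three vertices each, so \<open>S\<close> has at least four edges.\<close>

lemma essentially_4_edge_connected_cyclically_edge_connected:
  assumes sg: "simple_graph V E" and es: "essentially_4_edge_connected V E"
  shows "cyclically_edge_connected 4 V E"
  unfolding cyclically_edge_connected_def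
proof (rule notI, elim exE conjE bexE)
  fix S C D
  assume S: "S \<subseteq> E" "finite S" "card S < 4"
    and C: "C \<in> components V (E - S)" and D: "D \<in> components V (E - S)" and ne: "C \<noteq> D"
    and cC: "contains_cycle (E - S) C" and cD: "contains_cycle (E - S) D"
  have finV: "finite V" using sg unfolding simple_graph_def by simp
  let ?R = "(adj (E - S))\<^sup>*"
  have sym: "sym ?R" by (rule sym_rtrancl[OF sym_adj])
  obtain c d where c: "C = {w \<in> V. (c, w) \<in> ?R}" and d: "D = {w \<in> V. (d, w) \<in> ?R}"
    using C D unfolding components_def by blast
  have disj: "C \<inter> D = {}"
  proof (rule ccontr)
    assume "C \<inter> D \<noteq> {}"
    then obtain w where "(c, w) \<in> ?R" "(d, w) \<in> ?R" unfolding c d by blast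
    then have "(c, d) \<in> ?R" "(d, c) \<in> ?R" using sym by (meson rtrancl_trans symD)+
    then have "C = D" unfolding c d by (auto intro: rtrancl_trans)
    then show False using ne by simp
  qed
  have card3: "3 \<le> card X" if X: "contains_cycle (E - S) X" "X \<subseteq> V" for X
  proof -
    obtain p where "3 \<le> length p" "distinct p" "set p \<subseteq> X"
      using X(1) unfolding contains_cycle_def graph_cycle_def by blast
    then show ?thesis using card_mono[OF finite_subset[OF X(2) finV], of "set p"] distinct_card[of p] by simp
  qed
  have CV: "C \<subseteq> V" "D \<subseteq> V" unfolding c d by auto
  have "3 \<le> card C" "3 \<le> card (V - C)"
    proof -
    show "3 \<le> card C" by (rule card3[OF cC CV(1)])
    have "D \<subseteq> V - C" using disj CV by blast
    then show "3 \<le> card (V - C)" using card3[OF cD CV(2)] card_mono[of "V - C" D] finV by simp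
  qed
  moreover have "C \<noteq> {}" "C \<noteq> V" using \<open>3 \<le> card C\<close> \<open>3 \<le> card (V - C)\<close> by auto
  ultimately have 4: "4 \<le> card (edge_cut E C)" using es CV(1) unfolding essentially_4_edge_connected_def by simp
  have "edge_cut (E - S) C = {}" unfolding c by (rule cut_reachable[OF simple_graph_subset[OF sg]]) auto
  then have "edge_cut E C \<subseteq> S" unfolding edge_cut_def by blast
  then show False using 4 S card_mono[of S "edge_cut E C"] by simp
qed

section \<open>Gluing two parts along at most five independent edges\<close>

lemma cut_split:
  assumes "simple_graph V E" "C \<subseteq> U"
  shows "card (edge_cut E C) = card (edge_cut {e \<in> E. e \<subseteq> U} C) + card {e \<in> edge_cut E U. e \<inter> C \<noteq> {}}"
proof -
  have fin: "finite E" by (rule simple_graph_finite_edges[OF assms(1)])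
  have "card (edge_cut E C) = card (edge_cut {e \<in> E. e \<subseteq> U} C \<union> {e \<in> edge_cut E U. e \<inter> C \<noteq> {}})"
    using assms(2) unfolding edge_cut_def by (intro arg_cong[of _ _ card]) blast
  also have "\<dots> = card (edge_cut {e \<in> E. e \<subseteq> U} C) + card {e \<in> edge_cut E U. e \<inter> C \<noteq> {}}"
    using fin by (intro card_Un_disjoint) (auto simp: edge_cut_def)
  finally show ?thesis .
qed

text \<open>One of \<open>B\<close> and \<open>U - B\<close> meets at most two of the five edges leaving \<open>U\<close>.\<close>

lemma inner_cut_ge_2:
  assumes sg: "simple_graph V E" and UV: "U \<subseteq> V"
    and cardX: "card (edge_cut E U) \<le> 5" and one: "\<And>x. x \<in> U \<Longrightarrow> card {e \<in> edge_cut E U. x \<in> e} \<le> 1"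
    and c3: "\<And>C. C \<subseteq> U \<Longrightarrow> C \<noteq> {} \<Longrightarrow> 3 \<le> card (edge_cut E C)"
    and c4: "\<And>C. C \<subseteq> U \<Longrightarrow> 2 \<le> card C \<Longrightarrow> 4 \<le> card (edge_cut E C)"
    and B: "B \<subseteq> U" "B \<noteq> {}" "B \<noteq> U"
  shows "2 \<le> card (edge_cut {e \<in> E. e \<subseteq> U} B)"
proof -
  define F where "F = {e \<in> E. e \<subseteq> U}"
  define k where "k C = {e \<in> edge_cut E U. e \<inter> C \<noteq> {}}" for C
  have finU: "finite U" using sg UV unfolding simple_graph_def by (meson finite_subset)
  have finX: "finite (edge_cut E U)" using simple_graph_finite_edges[OF sg] finite_cut by blast
  have sgF: "simple_graph U F" using sg finU unfolding F_def simple_graph_def by simp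
  have split: "card (edge_cut E C) = card (edge_cut F C) + card (k C)" if "C \<subseteq> U" for C
    using cut_split[OF sg that] unfolding F_def k_def .
  \<comment> \<open>At most two of at least four cut edges leave \<open>U\<close>; for a single
    vertex, at most one of at least three.\<close>
  have small: "2 \<le> card (edge_cut F C)" if C: "C \<subseteq> U" "C \<noteq> {}" "card (k C) \<le> 2" for C
  proof (cases "2 \<le> card C")
    case True
    then show ?thesis using split[OF C(1)] c4[OF C(1)] C(3) by simp
  next
    case False
    moreover have "card C \<noteq> 0" using C finU by (simp add: finite_subset)
    ultimately have "card C = 1" by linarith
    then obtain x where "C = {x}" by (rule card_1_singletonE)
    then have "card (k C) \<le> 1" using one[of x] C(1) unfolding k_def by simp
    then show ?thesis using split[OF C(1)] c3[OF C(1,2)] by simp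
  qed
  \<comment> \<open>An edge leaving \<open>U\<close> has only one end in \<open>U\<close>.\<close>
  have "k B \<inter> k (U - B) = {}"
  proof (rule equals0I)
    fix e assume e: "e \<in> k B \<inter> k (U - B)"
    then have "e \<in> E" unfolding k_def edge_cut_def by blast
    then obtain x y where "e = {x, y}" by (rule simple_graph_edgeE[OF sg])
    then show False using e B(1) unfolding k_def edge_cut_def by auto
  qed
  then have "card (k B) + card (k (U - B)) = card (k B \<union> k (U - B))"
    using finX by (intro card_Un_disjoint[symmetric]) (auto simp: k_def)
  also have "\<dots> \<le> card (edge_cut E U)" by (intro card_mono finX) (auto simp: k_def)
  finally have "card (k B) \<le> 2 \<or> card (k (U - B)) \<le> 2" using cardX by linarith
  moreover have "edge_cut F (U - B) = edge_cut F B" by (rule cut_complement[OF sgF B(1)])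
  moreover have "U - B \<subseteq> U" "U - B \<noteq> {}" using B by blast+
  ultimately have "2 \<le> card (edge_cut F B)" using small[of B] small[of "U - B"] B by metis
  then show ?thesis unfolding F_def .
qed

text \<open>A set that splits both \<open>U\<close> and \<open>W\<close> cuts at least two edges
  inside each. Otherwise the set or its complement lies in one part, where the hypotheses apply
  directly.\<close>

lemma essentially_4_edge_connected_glue:
  assumes sg: "simple_graph V E" and V: "V = U \<union> W" "U \<inter> W = {}"
    and cardX: "card (edge_cut E U) \<le> 5" and one: "\<And>x. x \<in> V \<Longrightarrow> card {e \<in> edge_cut E U. x \<in> e} \<le> 1"
    and c3: "\<And>x. x \<in> V \<Longrightarrow> 3 \<le> card (edge_cut E {x})"
    and cU: "\<And>C. C \<subseteq> U \<Longrightarrow> 2 \<le> card C \<Longrightarrow> 4 \<le> card (edge_cut E C)"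
    and cW: "\<And>C. C \<subseteq> W \<Longrightarrow> 2 \<le> card C \<Longrightarrow> 4 \<le> card (edge_cut E C)"
  shows "essentially_4_edge_connected V E"
  unfolding essentially_4_edge_connected_def
proof (intro allI impI)
  fix A assume A: "A \<subseteq> V" "A \<noteq> {}" "A \<noteq> V"
  have finV: "finite V" using sg unfolding simple_graph_def by simp
  have XW: "edge_cut E W = edge_cut E U" using cut_complement[OF sg, of U] V by (simp add: Un_Diff Diff_triv Int_commute)
  have sub: "3 \<le> card (edge_cut E C)" "2 \<le> card C \<Longrightarrow> 4 \<le> card (edge_cut E C)"
    if C: "C \<subseteq> U \<or> C \<subseteq> W" "C \<noteq> {}" for C
  proof -
    show g: "4 \<le> card (edge_cut E C)" if "2 \<le> card C" using C(1) cU cW that by blast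
    show "3 \<le> card (edge_cut E C)"
    proof (cases "2 \<le> card C")
      case False
      moreover have "card C \<noteq> 0" using C V finV by (metis Un_upper1 Un_upper2 card_0_eq finite_subset)
      ultimately have "card C = 1" by linarith
      then obtain x where "C = {x}" by (rule card_1_singletonE)
      then show ?thesis using c3 C V by auto
    qed (use g in simp)
  qed
  have comp: "edge_cut E (V - A) = edge_cut E A" by (rule cut_complement[OF sg A(1)])
  consider "A \<subseteq> U \<or> A \<subseteq> W" | "V - A \<subseteq> U \<or> V - A \<subseteq> W"
    | "A \<inter> U \<noteq> {}" "A \<inter> W \<noteq> {}" "A \<inter> U \<noteq> U" "A \<inter> W \<noteq> W"
    using A V by blast
  then show "3 \<le> card (edge_cut E A) \<and> (2 \<le> card A \<longrightarrow> 2 \<le> card (V - A) \<longrightarrow> 4 \<le> card (edge_cut E A))"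
  proof cases
    case 1
    then show ?thesis using sub[of A] A(2) by blast
  next
    case 2
    moreover have "V - A \<noteq> {}" using A by blast
    ultimately show ?thesis using sub[of "V - A"] unfolding comp by blast
  next
    case 3
    have u: "2 \<le> card (edge_cut {e \<in> E. e \<subseteq> U} (A \<inter> U))"
    proof (rule inner_cut_ge_2[OF sg _ cardX])
      show "U \<subseteq> V" using V by blast
      show "card {e \<in> edge_cut E U. x \<in> e} \<le> 1" if "x \<in> U" for x using one that V by blast
      show "3 \<le> card (edge_cut E C)" if "C \<subseteq> U" "C \<noteq> {}" for C using sub(1) that by blast
      show "A \<inter> U \<subseteq> U" "A \<inter> U \<noteq> {}" "A \<inter> U \<noteq> U" using 3 by blast+
    qed (rule cU)
    have w: "2 \<le> card (edge_cut {e \<in> E. e \<subseteq> W} (A \<inter> W))"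
    proof (rule inner_cut_ge_2[OF sg])
      show "W \<subseteq> V" using V by blast
      show "card (edge_cut E W) \<le> 5" using XW cardX by simp
      show "card {e \<in> edge_cut E W. x \<in> e} \<le> 1" if "x \<in> W" for x unfolding XW using one that V by blast
      show "3 \<le> card (edge_cut E C)" if "C \<subseteq> W" "C \<noteq> {}" for C using sub(1) that by blast
      show "A \<inter> W \<subseteq> W" "A \<inter> W \<noteq> {}" "A \<inter> W \<noteq> W" using 3 by blast+
    qed (rule cW)
    have fin: "finite (edge_cut F C)" if "F \<subseteq> E" for F C
      using simple_graph_finite_edges[OF sg] that by (meson finite_cut finite_subset)
    have "card (edge_cut {e \<in> E. e \<subseteq> U} (A \<inter> U)) + card (edge_cut {e \<in> E. e \<subseteq> W} (A \<inter> W)) =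
        card (edge_cut {e \<in> E. e \<subseteq> U} (A \<inter> U) \<union> edge_cut {e \<in> E. e \<subseteq> W} (A \<inter> W))"
      using V by (intro card_Un_disjoint[symmetric] fin) (auto simp: edge_cut_def)
    also have "\<dots> \<le> card (edge_cut E A)"
      by (intro card_mono fin) (auto simp: edge_cut_def)
    finally show ?thesis using u w by linarith
  qed
qed

section \<open>Edge insertion\<close>

definition crossings :: "(nat \<times> nat) list \<Rightarrow> nat set \<Rightarrow> nat" where
  "crossings es A = length (filter (\<lambda>(x, y). (x \<in> A) \<noteq> (y \<in> A)) es)"

text \<open>The list form makes edge insertions executable; an edge is a pair in either
  orientation.\<close>

definition essentially_4_edge_connected_list :: "nat list \<Rightarrow> (nat \<times> nat) list \<Rightarrow> bool" where
  "essentially_4_edge_connected_list vs es \<longleftrightarrow> set es \<subseteq> set vs \<times> set vs \<and>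
     (\<forall>A\<subseteq>set vs. A \<noteq> {} \<longrightarrow> A \<noteq> set vs \<longrightarrow> 3 \<le> crossings es A \<and>
        (2 \<le> card A \<longrightarrow> 2 \<le> card (set vs - A) \<longrightarrow> 4 \<le> crossings es A))"

lemma crossings_Cons:
  "crossings ((x, y) # es) A = of_bool ((x \<in> A) \<noteq> (y \<in> A)) + crossings es A"
  unfolding crossings_def by simp

lemma crossings_remove1:
  "(x, y) \<in> set es \<Longrightarrow> crossings es A = of_bool ((x \<in> A) \<noteq> (y \<in> A)) + crossings (remove1 (x, y) es) A"
  by (induction es) (auto simp: crossings_Cons)

text \<open>Subdivide \<open>ab\<close> by \<open>u\<close> and \<open>cd\<close> by \<open>v\<close>, and join \<open>u\<close> to \<open>v\<close>.\<close>

fun insert_edge :: "nat \<times> nat \<times> nat \<times> nat \<times> nat \<times> nat \<Rightarrow> nat list \<times> (nat \<times> nat) list \<Rightarrow> nat list \<times> (nat \<times> nat) list" where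
  "insert_edge (a, b, c, d, u, v) (vs, es) =
     (u # v # vs, (a, u) # (u, b) # (c, v) # (v, d) # (u, v) # remove1 (c, d) (remove1 (a, b) es))"

fun insertable :: "nat \<times> nat \<times> nat \<times> nat \<times> nat \<times> nat \<Rightarrow> nat list \<times> (nat \<times> nat) list \<Rightarrow> bool" where
  "insertable (a, b, c, d, u, v) (vs, es) \<longleftrightarrow>
     (a, b) \<in> set es \<and> (c, d) \<in> set es \<and> distinct [a, b, c, d] \<and> u \<noteq> v \<and> u \<notin> set vs \<and> v \<notin> set vs"

text \<open>The trace \<open>A\<close> of \<open>A'\<close> on the old vertices cuts no more edges
  than \<open>A'\<close>, which settles the case that \<open>A\<close> and its complement both have
  two vertices. In the remaining cases a new vertex supplies the missing cut edge.\<close>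

lemma essentially_4_edge_connected_list_insert_edge:
  assumes g: "essentially_4_edge_connected_list vs es" and ins: "insertable (a, b, c, d, u, v) (vs, es)"
    and st: "insert_edge (a, b, c, d, u, v) (vs, es) = (vs', es')"
  shows "essentially_4_edge_connected_list vs' es'"
proof -
  define R where "R = remove1 (c, d) (remove1 (a, b) es)"
  have vs': "vs' = u # v # vs" and es': "es' = (a, u) # (u, b) # (c, v) # (v, d) # (u, v) # R"
    using st unfolding R_def by simp_all
  have ab: "(a, b) \<in> set es" and cd: "(c, d) \<in> set es" and dist: "distinct [a, b, c, d]"
    and uv: "u \<noteq> v" "u \<notin> set vs" "v \<notin> set vs" using ins by simp_all
  have sub: "set es \<subseteq> set vs \<times> set vs" using g unfolding essentially_4_edge_connected_list_def by blast
  have mem: "a \<in> set vs" "b \<in> set vs" "c \<in> set vs" "d \<in> set vs" using sub ab cd by blast+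
  have R: "set R \<subseteq> set es" unfolding R_def by (meson order_trans set_remove1_subset)
  have cd': "(c, d) \<in> set (remove1 (a, b) es)" using cd dist by (simp add: in_set_remove1)
  have old: "crossings es A = of_bool ((a \<in> A) \<noteq> (b \<in> A)) + of_bool ((c \<in> A) \<noteq> (d \<in> A)) + crossings R A" for A
    unfolding R_def crossings_remove1[OF ab] crossings_remove1[OF cd'] by simp
  have main: "3 \<le> crossings es' A' \<and> (2 \<le> card A' \<longrightarrow> 2 \<le> card (set vs' - A') \<longrightarrow> 4 \<le> crossings es' A')"
    if A': "A' \<subseteq> set vs'" "A' \<noteq> {}" "A' \<noteq> set vs'" for A'
  proof -
    define A where "A = A' \<inter> set vs"
    have Asub: "A \<subseteq> set vs" unfolding A_def by blast
    have fin: "finite A" "finite (set vs - A)" using Asub by (auto intro: finite_subset)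
    have in': "x \<in> A' \<longleftrightarrow> x \<in> A" if "x \<in> set vs" for x using that unfolding A_def by blast
    have "crossings R A' = crossings R A"
      unfolding crossings_def using R sub in' by (intro arg_cong[of _ _ length] filter_cong) auto
    then have new: "crossings es' A' = of_bool ((a \<in> A) \<noteq> (u \<in> A')) + of_bool ((u \<in> A') \<noteq> (b \<in> A)) +
        of_bool ((c \<in> A) \<noteq> (v \<in> A')) + of_bool ((v \<in> A') \<noteq> (d \<in> A)) + of_bool ((u \<in> A') \<noteq> (v \<in> A')) + crossings R A"
      unfolding es' crossings_Cons using in' mem by simp
    have A'eq: "A' = A \<union> {x. x = u \<and> u \<in> A'} \<union> {x. x = v \<and> v \<in> A'}"
      using A'(1) unfolding A_def vs' by auto
    have C'eq: "set vs' - A' = (set vs - A) \<union> {x. x = u \<and> u \<notin> A'} \<union> {x. x = v \<and> v \<notin> A'}"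
      unfolding vs' A_def using uv by auto
    have card1: "x = y" if "card A \<le> 1" "x \<in> A" "y \<in> A" for x y
      using that fin(1) by (metis card_le_Suc0_iff_eq One_nat_def)
    have card2: "x = y" if "card (set vs - A) \<le> 1" "x \<in> set vs - A" "y \<in> set vs - A" for x y
      using that fin(2) by (metis card_le_Suc0_iff_eq One_nat_def)
    have uvA: "2 \<le> card A' \<Longrightarrow> card A \<le> 1 \<Longrightarrow> u \<in> A' \<or> v \<in> A'"
      and uvB: "2 \<le> card A' \<Longrightarrow> A = {} \<Longrightarrow> u \<in> A' \<and> v \<in> A'"
    proof -
      assume c2: "2 \<le> card A'"
      show "u \<in> A' \<or> v \<in> A'" if "card A \<le> 1"
      proof (rule ccontr)
        assume "\<not> (u \<in> A' \<or> v \<in> A')"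
        then have "A' = A" using A'eq by auto
        then show False using c2 that by simp
      qed
      show "u \<in> A' \<and> v \<in> A'" if "A = {}"
      proof (rule ccontr)
        assume "\<not> (u \<in> A' \<and> v \<in> A')"
        then have "A' \<subseteq> {u} \<or> A' \<subseteq> {v}" using A'eq that by auto
        then have "card A' \<le> 1" using card_mono[of "{u}" A'] card_mono[of "{v}" A'] by auto
        then show False using c2 by simp
      qed
    qed
    have uvC: "2 \<le> card (set vs' - A') \<Longrightarrow> card (set vs - A) \<le> 1 \<Longrightarrow> u \<notin> A' \<or> v \<notin> A'"
      and uvD: "2 \<le> card (set vs' - A') \<Longrightarrow> set vs - A = {} \<Longrightarrow> u \<notin> A' \<and> v \<notin> A'"
    proof -
      assume c2: "2 \<le> card (set vs' - A')"
      show "u \<notin> A' \<or> v \<notin> A'" if "card (set vs - A) \<le> 1"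
      proof (rule ccontr)
        assume "\<not> (u \<notin> A' \<or> v \<notin> A')"
        then have "set vs' - A' = set vs - A" using C'eq by auto
        then show False using c2 that by simp
      qed
      show "u \<notin> A' \<and> v \<notin> A'" if "set vs - A = {}"
      proof (rule ccontr)
        assume "\<not> (u \<notin> A' \<and> v \<notin> A')"
        then have "set vs' - A' \<subseteq> {u} \<or> set vs' - A' \<subseteq> {v}" using C'eq that by auto
        then have "card (set vs' - A') \<le> 1"
          using card_mono[of "{u}" "set vs' - A'"] card_mono[of "{v}" "set vs' - A'"] by auto
        then show False using c2 by simp
      qed
    qed
    \<comment> \<open>If \<open>ab\<close> is cut, so is one of its halves \<open>au\<close>,
      \<open>ub\<close>; likewise for \<open>cd\<close>.\<close>
    have mono: "crossings es A \<le> crossings es' A'" unfolding new old by (auto simp: of_bool_def)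
    consider "A = {}" | "set vs - A = {}" | "card A = 1" "A \<noteq> set vs" | "card (set vs - A) = 1" "A \<noteq> {}"
      | "2 \<le> card A" "2 \<le> card (set vs - A)"
    proof -
      have "A = {} \<or> card A = 1 \<or> 2 \<le> card A" "set vs - A = {} \<or> card (set vs - A) = 1 \<or> 2 \<le> card (set vs - A)"
        using fin card_gt_0_iff[of A] card_gt_0_iff[of "set vs - A"] by linarith+
      then show ?thesis using that by blast
    qed
    then show ?thesis
    proof cases
      \<comment> \<open>Here \<open>A'\<close> consists of new vertices: one of them cuts three
        edges, both together cut four.\<close>
      case 1
      have "u \<in> A' \<or> v \<in> A'" using A'(2) A'eq 1 by auto
      then show ?thesis using uvB 1 unfolding new by auto
    next
      case 2
      then have m: "a \<in> A" "b \<in> A" "c \<in> A" "d \<in> A" using mem by auto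
      have "u \<notin> A' \<or> v \<notin> A'" using A'(1,3) C'eq 2 by auto
      then show ?thesis using uvD 2 m unfolding new by auto
    next
      \<comment> \<open>If just one of \<open>u, v\<close> is in \<open>A'\<close>, then
        \<open>uv\<close> is an additional cut edge. If both are, one of \<open>ab\<close>,
        \<open>cd\<close> has no end in the singleton \<open>A\<close>, and both its halves are
        cut.\<close>
      case 3
      then have "A \<noteq> {}" by auto
      then have "3 \<le> crossings es A" using g Asub 3 unfolding essentially_4_edge_connected_list_def by blast
      moreover have "4 \<le> crossings es' A'" if "2 \<le> card A'"
        using calculation uvA[OF that] 3 card1[of a b] card1[of a c] card1[of a d] card1[of b c] card1[of b d] card1[of c d] dist
        unfolding new old by (auto simp: of_bool_def split: if_splits)
      ultimately show ?thesis using mono by linarith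
    next
      case 4
      then have "A \<noteq> set vs" by auto
      then have "3 \<le> crossings es A" using g Asub 4 unfolding essentially_4_edge_connected_list_def by blast
      moreover have "4 \<le> crossings es' A'" if "2 \<le> card (set vs' - A')"
        using calculation uvC[OF that] 4 card2[of a b] card2[of a c] card2[of a d] card2[of b c] card2[of b d] card2[of c d] dist mem
        unfolding new old by (auto simp: of_bool_def split: if_splits)
      ultimately show ?thesis using mono by linarith
    next
      case 5
      then have "A \<noteq> {}" "A \<noteq> set vs" by auto
      then have "4 \<le> crossings es A" using g Asub 5 unfolding essentially_4_edge_connected_list_def by blast
      then show ?thesis using mono by linarith
    qed
  qed
  have "set es' \<subseteq> set vs' \<times> set vs'" using R sub mem unfolding es' vs' by auto
  then show ?thesis using main unfolding essentially_4_edge_connected_list_def by blast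
qed

fun insert_edges where
  "insert_edges [] st = Some st"
| "insert_edges (s # ss) st = (if insertable s st then insert_edges ss (insert_edge s st) else None)"

lemma essentially_4_edge_connected_list_insert_edges:
  "essentially_4_edge_connected_list vs es \<Longrightarrow> insert_edges ss (vs, es) = Some (vs', es') \<Longrightarrow> essentially_4_edge_connected_list vs' es'"
proof (induction ss arbitrary: vs es)
  case (Cons s ss)
  obtain a b c d u v where s: "s = (a, b, c, d, u, v)" by (cases s)
  obtain vs1 es1 where 1: "insert_edge s (vs, es) = (vs1, es1)" by (cases "insert_edge s (vs, es)")
  then show ?case using Cons essentially_4_edge_connected_list_insert_edge[of vs es a b c d u v vs1 es1] s by (auto split: if_splits)
qed auto

lemma essentially_4_edge_connected_list_K4:
  assumes "distinct [a, b, c, d]"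
  shows "essentially_4_edge_connected_list [a, b, c, d] [(a, b), (a, c), (a, d), (b, c), (b, d), (c, d)]"
  unfolding essentially_4_edge_connected_list_def
proof (intro conjI allI impI)
  fix A assume A: "A \<subseteq> set [a, b, c, d]" "A \<noteq> {}" "A \<noteq> set [a, b, c, d]"
  then have "A \<in> Pow {a, b, c, d}" by simp
  then show "3 \<le> crossings [(a, b), (a, c), (a, d), (b, c), (b, d), (c, d)] A"
    using A(2,3) assms by (auto simp: Pow_insert crossings_Cons crossings_def)
  assume "2 \<le> card A" "2 \<le> card (set [a, b, c, d] - A)"
  with \<open>A \<in> Pow {a, b, c, d}\<close> show "4 \<le> crossings [(a, b), (a, c), (a, d), (b, c), (b, d), (c, d)] A"
    using A(2,3) assms by (auto simp: Pow_insert crossings_Cons crossings_def insert_Diff_if)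
qed auto

lemma crossings_append: "crossings (es @ fs) A = crossings es A + crossings fs A"
  unfolding crossings_def by simp

lemma crossings_distinct:
  assumes "distinct es" "distinct fs" "set es = set fs"
  shows "crossings es A = crossings fs A"
proof -
  have "length (filter P es) = length (filter P fs)" for P
    using distinct_card[OF distinct_filter[OF assms(1)], of P] distinct_card[OF distinct_filter[OF assms(2)], of P] assms(3)
    by simp
  then show ?thesis unfolding crossings_def .
qed

text \<open>Normalising orientations allows the outcome of the insertions to be compared, as a set,
  with an explicit edge list.\<close>

lemma crossings_flip: "crossings (map (\<lambda>(x, y). (min x y, max x y)) es) A = crossings es A"
proof (induction es)
  case (Cons p es)
  then show ?case by (cases p) (auto simp: crossings_Cons min_def max_def)
qed simp

section \<open>Covers by four perfect matchings\<close>

text \<open>Indexing allows repeated matchings, so covers by fewer than four are included.\<close>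

definition four_coverable :: "'a set \<Rightarrow> 'a set set \<Rightarrow> bool" where
  "four_coverable V E \<longleftrightarrow>
     (\<exists>M :: nat \<Rightarrow> 'a set set. (\<forall>i<4. perfect_matching V E (M i)) \<and> (\<Union>i<4. M i) = E)"

lemma perfect_matching_index_ge_5:
  assumes nc: "\<not> four_coverable V E" and E: "E \<noteq> {}"
  shows "5 \<le> perfect_matching_index V E"
  unfolding perfect_matching_index_def
proof (rule INF_greatest)
  fix \<M> assume "\<M> \<in> {\<M>. finite \<M> \<and> (\<forall>M\<in>\<M>. perfect_matching V E M) \<and> \<Union>\<M> = E}"
  then have fin: "finite \<M>" and pm: "\<And>M. M \<in> \<M> \<Longrightarrow> perfect_matching V E M" and un: "\<Union>\<M> = E" by auto
  have "5 \<le> card \<M>"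
  proof (rule ccontr)
    assume "\<not> 5 \<le> card \<M>"
    then have le: "card \<M> \<le> 4" by simp
    \<comment> \<open>A nonempty \<open>E\<close> guarantees a matching with which to pad the
      family.\<close>
    have pos: "0 < card \<M>" using fin un E by (auto simp: card_gt_0_iff)
    obtain f where f: "bij_betw f {0..<card \<M>} \<M>" using ex_bij_betw_nat_finite[OF fin] by blast
    \<comment> \<open>Surplus indices repeat the last matching.\<close>
    let ?M = "\<lambda>i. f (min i (card \<M> - 1))"
    have "?M ` {..<4} = \<M>"
    proof -
      have "(\<lambda>i. min i (card \<M> - 1)) ` {..<4} = {0..<card \<M>}"
      proof (intro equalityI subsetI)
        fix j assume "j \<in> {0..<card \<M>}"
        then show "j \<in> (\<lambda>i. min i (card \<M> - 1)) ` {..<4}" using le by (intro image_eqI[of _ _ j]) auto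
      qed (use pos in auto)
      then have "f ` (\<lambda>i. min i (card \<M> - 1)) ` {..<4} = \<M>" using f by (simp add: bij_betw_def)
      then show ?thesis by (simp only: image_image)
    qed
    then have "four_coverable V E" unfolding four_coverable_def using pm un by (intro exI[of _ ?M]) auto
    then show False using nc by simp
  qed
  then show "5 \<le> enat (card \<M>)" by (simp add: numeral_eq_enat)
qed

text \<open>All three colours occur at each vertex, so colour classes are perfect matchings;
  \<open>min i 2\<close> repeats the third one as the fourth.\<close>

lemma four_coverable_if_3_edge_colourable:
  assumes cb: "cubic V E" and label: "proper_edge_colouring 3 E c"
  shows "four_coverable V E"
proof -
  let ?M = "\<lambda>i. {e \<in> E. c e = min i 2}"
  have "perfect_matching V E (?M i)" for i
    unfolding perfect_matching_def
  proof (intro conjI ballI)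
    fix v assume v: "v \<in> V"
    let ?F = "{e \<in> E. v \<in> e}"
    have card: "card ?F = 3" using cb v unfolding cubic_def by blast
    have inj: "inj_on c ?F" using label unfolding proper_edge_colouring_def inj_on_def by blast
    have "c ` ?F \<subseteq> {..<3}" using label unfolding proper_edge_colouring_def by auto
    then have "c ` ?F = {..<3}" using card card_image[OF inj] by (simp add: card_subset_eq)
    then have "min i 2 \<in> c ` ?F" by simp
    then obtain e where "e \<in> ?F" "c e = min i 2" by (metis (no_types, lifting) imageE)
    then show "\<exists>!e. e \<in> ?M i \<and> v \<in> e" using inj unfolding inj_on_def by (intro ex1I[of _ e]) auto
  qed auto
  moreover have "(\<Union>i<4. ?M i) = E"
  proof -
    have "e \<in> ?M (c e)" "c e < 4" if "e \<in> E" for e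
      using label that unfolding proper_edge_colouring_def by fastforce+
    then show ?thesis by blast
  qed
  ultimately show ?thesis unfolding four_coverable_def by (intro exI[of _ ?M]) auto
qed

text \<open>\<open>S1\<close> stands for the set \<open>{1}\<close> and \<open>D12\<close> for \<open>{1, 2}\<close>; \<open>tri a b c\<close> says that the three sets partition
  \<open>{1, 2, 3, 4}\<close>.\<close>

datatype label = S1 | S2 | S3 | S4 | D12 | D13 | D14 | D23 | D24 | D34

text \<open>A table, so that the finite checks below can be evaluated. Each edge at a vertex lies in
  some matching, so none of the three sets is empty and their sizes are 1, 1, 2.\<close>

primrec completions :: "label \<Rightarrow> (label \<times> label) list" where
  "completions S1 = [(S2, D34), (S3, D24), (S4, D23), (D34, S2), (D24, S3), (D23, S4)]"
| "completions S2 = [(S1, D34), (S3, D14), (S4, D13), (D34, S1), (D14, S3), (D13, S4)]"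
| "completions S3 = [(S1, D24), (S2, D14), (S4, D12), (D24, S1), (D14, S2), (D12, S4)]"
| "completions S4 = [(S1, D23), (S2, D13), (S3, D12), (D23, S1), (D13, S2), (D12, S3)]"
| "completions D12 = [(S3, S4), (S4, S3)]"
| "completions D13 = [(S2, S4), (S4, S2)]"
| "completions D14 = [(S2, S3), (S3, S2)]"
| "completions D23 = [(S1, S4), (S4, S1)]"
| "completions D24 = [(S1, S3), (S3, S1)]"
| "completions D34 = [(S1, S2), (S2, S1)]"

definition tri :: "label \<Rightarrow> label \<Rightarrow> label \<Rightarrow> bool" where
  "tri a b c \<longleftrightarrow> (b, c) \<in> set (completions a)"

fun label_of :: "bool \<Rightarrow> bool \<Rightarrow> bool \<Rightarrow> bool \<Rightarrow> label" where
  "label_of a b c d =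
    (if a then if b then D12 else if c then D13 else if d then D14 else S1
     else if b then if c then D23 else if d then D24 else S2
     else if c then if d then D34 else S3 else S4)"

lemma tri_label_of:
  assumes "\<And>i. i < 4 \<Longrightarrow> p i \<and> \<not> q i \<and> \<not> r i \<or> \<not> p i \<and> q i \<and> \<not> r i \<or> \<not> p i \<and> \<not> q i \<and> r i"
    and "\<exists>i<4. p i" "\<exists>i<4. q i" "\<exists>i<4::nat. r i"
  shows "tri (label_of (p 0) (p 1) (p 2) (p 3)) (label_of (q 0) (q 1) (q 2) (q 3)) (label_of (r 0) (r 1) (r 2) (r 3))"
proof -
  have 4: "(\<exists>i<4. s i) \<longleftrightarrow> s 0 \<or> s 1 \<or> s 2 \<or> s (3::nat)" for s
    by (auto simp: numeral_eq_Suc less_Suc_eq)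
  \<comment> \<open>There are 81 ways to distribute the four indices; the premises discard those
    that leave one of the three sets empty.\<close>
  have "(p 0 \<or> p 1 \<or> p 2 \<or> p 3) \<longrightarrow> (q 0 \<or> q 1 \<or> q 2 \<or> q 3) \<longrightarrow> (r 0 \<or> r 1 \<or> r 2 \<or> r 3) \<longrightarrow> ?thesis"
    using assms(1)[of 0, simplified] assms(1)[of 1, simplified] assms(1)[of 2, simplified] assms(1)[of 3, simplified]
    unfolding tri_def by (elim disjE conjE; simp)
  then show ?thesis using assms(2-4) unfolding 4 by blast
qed

text \<open>Each matching contains exactly one of the three edges at \<open>v\<close>, and each edge
  lies in some matching, so the labels at \<open>v\<close> form a partition.\<close>

lemma four_coverable_colouring:
  assumes "four_coverable V E"
  obtains c :: "'a set \<Rightarrow> label" where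
    "\<And>v e f g. v \<in> V \<Longrightarrow> {e \<in> E. v \<in> e} = {e, f, g} \<Longrightarrow> distinct [e, f, g] \<Longrightarrow> tri (c e) (c f) (c g)"
proof -
  obtain M :: "nat \<Rightarrow> 'a set set"
    where pm: "\<And>i. i < 4 \<Longrightarrow> perfect_matching V E (M i)" and un: "(\<Union>i<4. M i) = E"
    using assms unfolding four_coverable_def by blast
  define c where "c e = label_of (e \<in> M 0) (e \<in> M 1) (e \<in> M 2) (e \<in> M 3)" for e
  show ?thesis
  proof
    fix v e f g assume v: "v \<in> V" and ev: "{e \<in> E. v \<in> e} = {e, f, g}" and d: "distinct [e, f, g]"
    have mem: "e \<in> E" "f \<in> E" "g \<in> E" and inc: "v \<in> e" "v \<in> f" "v \<in> g" using ev by blast+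
    have "e \<in> M i \<and> f \<notin> M i \<and> g \<notin> M i \<or> e \<notin> M i \<and> f \<in> M i \<and> g \<notin> M i \<or> e \<notin> M i \<and> f \<notin> M i \<and> g \<in> M i"
      if i: "i < 4" for i
    proof -
      obtain h where h: "h \<in> M i" "v \<in> h" and u: "\<And>h'. h' \<in> M i \<Longrightarrow> v \<in> h' \<Longrightarrow> h' = h"
        using pm[OF i] v unfolding perfect_matching_def by blast
      have "h \<in> E" using pm[OF i] h unfolding perfect_matching_def by blast
      then have "h \<in> {e, f, g}" using h ev by blast
      moreover have "e \<in> M i \<longleftrightarrow> e = h" "f \<in> M i \<longleftrightarrow> f = h" "g \<in> M i \<longleftrightarrow> g = h"
        using h u inc by blast+
      ultimately show ?thesis using d by auto
    qed
    moreover have "\<exists>i<4. h \<in> M i" if "h \<in> E" for h using un that by blast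
    ultimately show "tri (c e) (c f) (c g)"
      unfolding c_def using tri_label_of[of "\<lambda>i. e \<in> M i" "\<lambda>i. f \<in> M i" "\<lambda>i. g \<in> M i"] mem by blast
  qed
qed

section \<open>Graphs given by neighbour lists\<close>

text \<open>The conditions \<open>a \<noteq> c\<close> and \<open>b \<noteq> d\<close> exclude
  closed walks that turn back along an edge.\<close>

lemma girth_ge_5:
  assumes no3: "\<And>a b c. {a, b} \<in> E \<Longrightarrow> {b, c} \<in> E \<Longrightarrow> {c, a} \<in> E \<Longrightarrow> False"
    and no4: "\<And>a b c d. {a, b} \<in> E \<Longrightarrow> {b, c} \<in> E \<Longrightarrow> {c, d} \<in> E \<Longrightarrow> {d, a} \<in> E \<Longrightarrow> a \<noteq> c \<Longrightarrow> b \<noteq> d \<Longrightarrow> False"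
  shows "5 \<le> girth E"
  unfolding girth_def
proof (rule INF_greatest)
  fix p assume "p \<in> {p. graph_cycle E p}"
  then have p: "3 \<le> length p" "distinct p" and e: "\<And>i. i < length p \<Longrightarrow> {p ! i, p ! (Suc i mod length p)} \<in> E"
    unfolding graph_cycle_def by auto
  have "length p \<noteq> 3"
  proof
    assume l: "length p = 3"
    have "{p ! 0, p ! 1} \<in> E" "{p ! 1, p ! 2} \<in> E" "{p ! 2, p ! 0} \<in> E"
      using e[of 0] e[of 1] e[of 2] unfolding l Suc_eq_plus1 one_add_one by simp_all
    then show False by (rule no3)
  qed
  moreover have "length p \<noteq> 4"
  proof
    assume l: "length p = 4"
    have "{p ! 0, p ! 1} \<in> E" "{p ! 1, p ! 2} \<in> E" "{p ! 2, p ! 3} \<in> E" "{p ! 3, p ! 0} \<in> E"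
      using e[of 0] e[of 1] e[of 2] e[of 3] unfolding l Suc_eq_plus1 one_add_one by simp_all
    moreover have "p ! 0 \<noteq> p ! 2" "p ! 1 \<noteq> p ! 3" using nth_eq_iff_index_eq[OF p(2), of 0 2] nth_eq_iff_index_eq[OF p(2), of 1 3] l by simp_all
    ultimately show False by (rule no4)
  qed
  ultimately have "5 \<le> length p" using p(1) by linarith
  then show "5 \<le> enat (length p)" by (simp add: numeral_eq_enat)
qed

definition nbr_lists :: "nat \<Rightarrow> (nat \<Rightarrow> nat list) \<Rightarrow> bool" where
  "nbr_lists n nb \<longleftrightarrow> (\<forall>x<n. length (nb x) = 3 \<and> distinct (nb x) \<and>
     (\<forall>y\<in>set (nb x). y < n \<and> y \<noteq> x \<and> x \<in> set (nb y)))"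

definition nbr_graph :: "nat \<Rightarrow> (nat \<Rightarrow> nat list) \<Rightarrow> nat set set" where
  "nbr_graph n nb = {{x, y} | x y. x < n \<and> y \<in> set (nb x)}"

context
  fixes n :: nat and nb :: "nat \<Rightarrow> nat list"
  assumes nb: "nbr_lists n nb"
begin

lemma nbr_listsD:
  assumes "x < n"
  shows "length (nb x) = 3" "distinct (nb x)" "y \<in> set (nb x) \<Longrightarrow> y < n" "x \<notin> set (nb x)"
    "y \<in> set (nb x) \<Longrightarrow> x \<in> set (nb y)"
  using nb assms unfolding nbr_lists_def by blast+

lemma nbr_graph_edge_iff: "{x, y} \<in> nbr_graph n nb \<longleftrightarrow> x < n \<and> y \<in> set (nb x)"
proof
  assume "{x, y} \<in> nbr_graph n nb"
  then obtain a b where "{x, y} = {a, b}" "a < n" "b \<in> set (nb a)" unfolding nbr_graph_def by blast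
  then show "x < n \<and> y \<in> set (nb x)" using nbr_listsD(3,5)[of a b] by (metis doubleton_eq_iff)
qed (auto simp: nbr_graph_def)

lemma nbr_graph_simple: "simple_graph {..<n} (nbr_graph n nb)"
  unfolding simple_graph_def
proof (intro conjI ballI)
  fix e assume "e \<in> nbr_graph n nb"
  then obtain a b where e: "e = {a, b}" "a < n" "b \<in> set (nb a)" unfolding nbr_graph_def by blast
  then have "b < n" "a \<noteq> b" using nbr_listsD(3,4)[of a] by blast+
  then show "e \<subseteq> {..<n}" "card e = 2" using e by auto
qed simp

lemma nbr_graph_edges_at:
  assumes "x < n"
  shows "{e \<in> nbr_graph n nb. x \<in> e} = (\<lambda>y. {x, y}) ` set (nb x)" (is "?L = ?R")
proof
  show "?L \<subseteq> ?R"
  proof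
    fix e assume e: "e \<in> ?L"
    then obtain a b where "e = {a, b}" using simple_graph_edgeE[OF nbr_graph_simple] by blast
    then obtain y where y: "e = {x, y}" using e by blast
    then show "e \<in> ?R" using e nbr_graph_edge_iff by auto
  qed
  show "?R \<subseteq> ?L" using assms unfolding nbr_graph_def by auto
qed

lemma nbr_graph_cubic: "cubic {..<n} (nbr_graph n nb)"
  unfolding cubic_def
proof
  fix x assume "x \<in> {..<n}"
  then have x: "x < n" by simp
  have "inj_on (\<lambda>y. {x, y}) (set (nb x))" by (auto simp: inj_on_def doubleton_eq_iff)
  then have "card ((\<lambda>y. {x, y}) ` set (nb x)) = card (set (nb x))" by (rule card_image)
  then show "card {e \<in> nbr_graph n nb. x \<in> e} = 3"
    using nbr_graph_edges_at[OF x] distinct_card[OF nbr_listsD(2)[OF x]] nbr_listsD(1)[OF x] by simp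
qed

text \<open>Directing edges out of \<open>A\<close> makes the map from pairs to edges injective, so
  cut bounds follow by exhibiting enough pairs.\<close>

lemma nbr_graph_cut_ge:
  assumes A: "A \<subseteq> {..<n}" and P: "\<And>x y. (x, y) \<in> P \<Longrightarrow> x \<in> A \<and> y \<in> set (nb x) \<and> y \<notin> A"
  shows "card P \<le> card (edge_cut (nbr_graph n nb) A)"
proof (rule card_inj_on_le)
  show "inj_on (\<lambda>(x, y). {x, y}) P"
  proof (rule inj_onI, clarify)
    fix x y x' y' assume "(x, y) \<in> P" "(x', y') \<in> P" "{x, y} = {x', y'}"
    then show "x = x' \<and> y = y'" using P[of x y] P[of x' y'] by (auto simp: doubleton_eq_iff)
  qed
  show "(\<lambda>(x, y). {x, y}) ` P \<subseteq> edge_cut (nbr_graph n nb) A"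
  proof clarify
    fix x y assume "(x, y) \<in> P"
    then have "x \<in> A" "y \<in> set (nb x)" "y \<notin> A" using P by blast+
    then show "{x, y} \<in> edge_cut (nbr_graph n nb) A" using A unfolding edge_cut_def nbr_graph_def by auto
  qed
  show "finite (edge_cut (nbr_graph n nb) A)"
    using simple_graph_finite_edges[OF nbr_graph_simple] finite_cut by blast
qed

end

lemma nbr_graph_colouring:
  assumes nb: "nbr_lists n nb" and fc: "four_coverable {..<n} (nbr_graph n nb)"
  obtains k where "\<And>x y. k x y = k y x"
    "\<And>x a b c. x < n \<Longrightarrow> nb x = [a, b, c] \<Longrightarrow> tri (k x a) (k x b) (k x c)"
proof -
  obtain c where c: "\<And>v e f g. v \<in> {..<n} \<Longrightarrow> {e \<in> nbr_graph n nb. v \<in> e} = {e, f, g} \<Longrightarrow>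
      distinct [e, f, g] \<Longrightarrow> tri (c e) (c f) (c g)"
    using four_coverable_colouring[OF fc] by blast
  show ?thesis
  proof
    show "c {x, y} = c {y, x}" for x y by (simp add: insert_commute)
    fix x p q r assume x: "x < n" and l: "nb x = [p, q, r]"
    have "distinct [p, q, r]" using nbr_listsD(2)[OF nb x] l by simp
    then have "distinct [{x, p}, {x, q}, {x, r}]" by (auto simp: doubleton_eq_iff)
    moreover have "{e \<in> nbr_graph n nb. x \<in> e} = {{x, p}, {x, q}, {x, r}}"
      unfolding nbr_graph_edges_at[OF nb x] l by simp
    ultimately show "tri (c {x, p}) (c {x, q}) (c {x, r})"
      using c[of x "{x, p}" "{x, q}" "{x, r}"] x by simp
  qed
qed

section \<open>Labellings of the windmill\<close>

definition labels :: "label list" where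
  "labels = [S1, S2, S3, S4, D12, D13, D14, D23, D24, D34]"

text \<open>The characteristic vector of the label as a subset of {1, 2, 3, 4}; \<open>xor4\<close>
  is then the symmetric difference.\<close>

primrec bits :: "label \<Rightarrow> bool \<times> bool \<times> bool \<times> bool" where
  "bits S1 = (True, False, False, False)"
| "bits S2 = (False, True, False, False)"
| "bits S3 = (False, False, True, False)"
| "bits S4 = (False, False, False, True)"
| "bits D12 = (True, True, False, False)"
| "bits D13 = (True, False, True, False)"
| "bits D14 = (True, False, False, True)"
| "bits D23 = (False, True, True, False)"
| "bits D24 = (False, True, False, True)"
| "bits D34 = (False, False, True, True)"

fun xor4 :: "bool \<times> bool \<times> bool \<times> bool \<Rightarrow> bool \<times> bool \<times> bool \<times> bool \<Rightarrow> bool \<times> bool \<times> bool \<times> bool" where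
  "xor4 (a, b, c, d) (a', b', c', d') = (a \<noteq> a', b \<noteq> b', c \<noteq> c', d \<noteq> d')"

primrec dbl :: "label \<Rightarrow> nat" where
  "dbl S1 = 0" | "dbl S2 = 0" | "dbl S3 = 0" | "dbl S4 = 0"
| "dbl D12 = 1" | "dbl D13 = 1" | "dbl D14 = 1" | "dbl D23 = 1" | "dbl D24 = 1" | "dbl D34 = 1"

text \<open>At most one entry: the complement of the union of \<open>a\<close> and \<open>b\<close>
  if these are disjoint and do not exhaust {1, 2, 3, 4}.\<close>

definition third :: "label \<Rightarrow> label \<Rightarrow> label list" where
  "third a b = map snd (filter (\<lambda>(x, y). x = b) (completions a))"


text \<open>\<open>a, b\<close> and \<open>c, d\<close> are the labels of the dangling edges of the 4-pole at the two removed vertices. The first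
  condition is parity; the second holds because the Petersen graph has no cover by four perfect
  matchings, so the labels cannot fit around the removed edge.\<close>

definition core_rel :: "label \<Rightarrow> label \<Rightarrow> label \<Rightarrow> label \<Rightarrow> bool" where
  "core_rel a b c d \<longleftrightarrow> xor4 (bits a) (bits b) = xor4 (bits c) (bits d) \<and>
     \<not> (third a b \<noteq> [] \<and> third a b = third c d)"

text \<open>For boundary labels \<open>a, b\<close> on one side of the 4-pole, the possible numbers of double edges on the
  other side.\<close>

definition dbl_sums :: "label \<Rightarrow> label \<Rightarrow> nat list" where
  "dbl_sums a b = (if a = b then [0, 2]
     else if third a b \<noteq> [] then (if dbl a + dbl b = 0 then [2] else [])
     else if dbl a + dbl b = 1 then [1]
     else if xor4 (bits a) (bits b) = (True, True, True, True) then [2] else [0, 2])"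

text \<open>The count is recorded in both directions because the outer 4-poles are attached
  differently: the one on 0-7 faces the hub with the side of 0 and 4, the one on 8-15 with the side
  of 10 and 11, which correspond to 2 and 3.\<close>

definition core_ok :: "label \<Rightarrow> label \<Rightarrow> label \<Rightarrow> label \<Rightarrow> bool" where
  "core_ok a b c d \<longleftrightarrow> core_rel a b c d \<and>
     dbl c + dbl d \<in> set (dbl_sums a b) \<and> dbl a + dbl b \<in> set (dbl_sums c d)"

text \<open>The bound names \<open>eij\<close> and \<open>wi\<close> are the labels of the edge \<open>ij\<close> and of the dangling edge at \<open>i\<close>, the vertices
  being numbered as the first eight vertices of \<open>windmill\<close>.\<close>

definition core_check :: bool where
  "core_check =
     list_all (\<lambda>e01. list_all (\<lambda>(e12, e16).
       list_all (\<lambda>(w0, e05). list_all (\<lambda>(w2, e27). list_all (\<lambda>(e47, e57).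
       list_all (\<lambda>e35. list_all (\<lambda>(e36, e46). list_all (\<lambda>w3. list_all (\<lambda>w4.
         core_ok w2 w3 w0 w4) (third e46 e47)) (third e35 e36)) (completions e16)) (third e05 e57))
       (completions e27)) (completions e12)) (completions e01)) (completions e01)) labels"

text \<open>The vertices are treated in the order 1, 0, 2, 7, 5, 6, 3, 4, each time ranging only
  over labels that fit those already chosen, which keeps the evaluation small.\<close>

lemma core_check: core_check
  by code_simp

text \<open>The core of the windmill is one 4-pole, with boundary \<open>c, d\<close> and \<open>e, f\<close>; either side leads over a path on three
  vertices to another 4-pole. Collected here are the possible labels of the edge from the path to the
  hub, paired with the number of double edges dangling from the far side of that other 4-pole.\<close>

definition hub_half :: "label \<Rightarrow> label \<Rightarrow> (label \<times> nat) list" where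
  "hub_half c d = remdups (concat (map (\<lambda>(a, x). concat (map (\<lambda>(b, y).
     concat (map (\<lambda>t. map (Pair t) (dbl_sums a b)) (third x y))) (completions d))) (completions c)))"

text \<open>\<open>Suc (dbl w)\<close> is the number of double edges that counting in the bipartite
  strip forces on the four outer edges.\<close>

definition halves_ok :: "(label \<times> nat) list \<Rightarrow> (label \<times> nat) list \<Rightarrow> bool" where
  "halves_ok h k = list_all (\<lambda>(t, m). list_all (\<lambda>(s, n). list_all (\<lambda>w. m + n \<noteq> Suc (dbl w)) (third t s)) k) h"

text \<open>\<open>c, d\<close> are the boundary labels at 20 and 16, and \<open>e, f\<close> those
  at 19 and 18, of the middle 4-pole; hence the order of arguments in
  \<open>core_rel\<close>.\<close>

definition hub_check :: bool where
  "hub_check = list_all (\<lambda>c. list_all (\<lambda>d. list_all (\<lambda>e. list_all (\<lambda>f. halves_ok (hub_half c d) (hub_half e f))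
     (filter (\<lambda>f. core_rel f e d c) labels)) labels) labels) labels"

lemma hub_check: hub_check
  by code_simp

lemma tri_commute: "tri a b c \<Longrightarrow> tri b a c" "tri a b c \<Longrightarrow> tri a c b"
  unfolding tri_def by (cases a; auto)+

lemma dbl_tri: "tri a b c \<Longrightarrow> dbl a + dbl b + dbl c = 1"
  unfolding tri_def by (cases a) auto

lemma in_labels: "a \<in> set labels"
  by (cases a) (simp_all add: labels_def)

lemma in_third_iff: "c \<in> set (third a b) \<longleftrightarrow> tri a b c"
  unfolding third_def tri_def by force

lemma core_colouring:
  assumes "tri e01 e12 e16" "tri e01 w0 e05" "tri e12 w2 e27" "tri e27 e47 e57" "tri e05 e57 e35"
    "tri e16 e36 e46" "tri e35 e36 w3" "tri e46 e47 w4"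
  shows "core_ok w2 w3 w0 w4"
proof -
  note c = core_check[unfolded core_check_def list_all_iff in_third_iff, rule_format]
  from c[OF in_labels, of "(e12, e16)" e01] assms(1)
  have "\<forall>p\<in>set (completions e01). case p of (w0, e05) \<Rightarrow> \<forall>p\<in>set (completions e12). case p of (w2, e27) \<Rightarrow>
      \<forall>p\<in>set (completions e27). case p of (e47, e57) \<Rightarrow> \<forall>e35. tri e05 e57 e35 \<longrightarrow>
      (\<forall>p\<in>set (completions e16). case p of (e36, e46) \<Rightarrow> \<forall>w3. tri e35 e36 w3 \<longrightarrow> (\<forall>w4. tri e46 e47 w4 \<longrightarrow>
        core_ok w2 w3 w0 w4))"
    by (simp add: in_third_iff tri_def Ball_def)
  then show ?thesis using assms unfolding tri_def by fast
qed

lemma in_concat_map: "x \<in> set xs \<Longrightarrow> y \<in> set (f x) \<Longrightarrow> y \<in> set (concat (map f xs))"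
  by auto

text \<open>\<open>c, d\<close> belong to the middle 4-pole and \<open>a, b\<close> to an outer one;
  the three \<open>tri\<close> hypotheses are the ends and the centre of the path between
  them.\<close>

lemma in_hub_half:
  assumes "tri c a x" "tri d b y" "tri x y t" "m \<in> set (dbl_sums a b)"
  shows "(t, m) \<in> set (hub_half c d)"
proof -
  have 1: "(a, x) \<in> set (completions c)" and 2: "(b, y) \<in> set (completions d)" and 3: "t \<in> set (third x y)"
    using assms(1-3) by (simp_all add: tri_def in_third_iff)
  have "(t, m) \<in> set (concat (map (\<lambda>t. map (Pair t) (dbl_sums a b)) (third x y)))"
    by (rule in_concat_map[OF 3]) (use assms(4) in simp)
  from in_concat_map[OF 2, of "(t, m)" "\<lambda>(b, y). concat (map (\<lambda>t. map (Pair t) (dbl_sums a b)) (third x y))"] this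
  have "(t, m) \<in> set (concat (map (\<lambda>(b, y). concat (map (\<lambda>t. map (Pair t) (dbl_sums a b)) (third x y))) (completions d)))"
    unfolding prod.case by blast
  from in_concat_map[OF 1, of "(t, m)" "\<lambda>(a, x). concat (map (\<lambda>(b, y).
      concat (map (\<lambda>t. map (Pair t) (dbl_sums a b)) (third x y))) (completions d))"] this
  show ?thesis unfolding hub_half_def set_remdups prod.case by blast
qed

lemma hub_colouring:
  assumes "core_rel f e d c" "(t, m) \<in> set (hub_half c d)" "(s, n) \<in> set (hub_half e f)" "tri t s w"
  shows "m + n \<noteq> Suc (dbl w)"
proof -
  have "halves_ok (hub_half c d) (hub_half e f)"
    using hub_check in_labels assms(1) unfolding hub_check_def list_all_iff by auto
  then have "\<forall>(s, n)\<in>set (hub_half e f). \<forall>w\<in>set (third t s). m + n \<noteq> Suc (dbl w)"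
    using assms(2) unfolding halves_ok_def list_all_iff by blast
  then have "\<forall>w\<in>set (third t s). m + n \<noteq> Suc (dbl w)" using assms(3) by blast
  then show ?thesis using assms(4) in_third_iff by blast
qed

text \<open>Neighbour lists. The vertices 0-7, 8-15 and 16-23 form the three 4-poles, 30 is the hub, and \<open>a, b, c, d, e\<close> are
  the outer ends of the dangling edges at 3, 8, 2, 12 and 30.\<close>

definition windmill :: "nat \<Rightarrow> nat \<Rightarrow> nat \<Rightarrow> nat \<Rightarrow> nat \<Rightarrow> nat list list" where
  "windmill a b c d e =
    [[1, 5, 27], [0, 2, 6], [1, 7, c], [5, 6, a], [6, 7, 28], [0, 3, 7], [1, 3, 4], [2, 4, 5],
     [9, 13, b], [8, 10, 14], [9, 15, 25], [13, 14, 24], [14, 15, d], [8, 11, 15], [9, 11, 12], [10, 12, 13],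
     [17, 21, 24], [16, 18, 22], [17, 23, 28], [21, 22, 27], [22, 23, 25], [16, 19, 23], [17, 19, 20], [18, 20, 21],
     [11, 16, 26], [10, 20, 26], [24, 25, 30], [0, 19, 29], [4, 18, 29], [27, 28, 30], [26, 29, e]]"

text \<open>The middle 4-pole is 16-23. The paths 24, 26, 25 and 27, 29, 28 lead from it to the
  other two, and their centres meet at the hub 30, where \<open>hub_colouring\<close>
  applies.\<close>

lemma windmill_colouring:
  assumes sym: "\<And>x y. k x y = (k y x :: label)"
    and tri: "\<And>x p q r. x < 31 \<Longrightarrow> windmill a b c d e ! x = [p, q, r] \<Longrightarrow> tri (k x p) (k x q) (k x r)"
  shows "dbl (k 2 c) + dbl (k 3 a) + dbl (k 8 b) + dbl (k 12 d) \<noteq> Suc (dbl (k 30 e))"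
proof -
  note t = tri[unfolded windmill_def]
  have v: "tri (k 0 1) (k 0 5) (k 0 27)" "tri (k 1 0) (k 1 2) (k 1 6)" "tri (k 2 1) (k 2 7) (k 2 c)"
    "tri (k 3 5) (k 3 6) (k 3 a)" "tri (k 4 6) (k 4 7) (k 4 28)" "tri (k 5 0) (k 5 3) (k 5 7)"
    "tri (k 6 1) (k 6 3) (k 6 4)" "tri (k 7 2) (k 7 4) (k 7 5)"
    using t[of 0] t[of 1] t[of 2] t[of 3] t[of 4] t[of 5] t[of 6] t[of 7] by simp_all
  have v': "tri (k 8 9) (k 8 13) (k 8 b)" "tri (k 9 8) (k 9 10) (k 9 14)" "tri (k 10 9) (k 10 15) (k 10 25)"
    "tri (k 11 13) (k 11 14) (k 11 24)" "tri (k 12 14) (k 12 15) (k 12 d)" "tri (k 13 8) (k 13 11) (k 13 15)"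
    "tri (k 14 9) (k 14 11) (k 14 12)" "tri (k 15 10) (k 15 12) (k 15 13)"
    using t[of 8] t[of 9] t[of 10] t[of 11] t[of 12] t[of 13] t[of 14] t[of 15] by simp_all
  have v'': "tri (k 16 17) (k 16 21) (k 16 24)" "tri (k 17 16) (k 17 18) (k 17 22)" "tri (k 18 17) (k 18 23) (k 18 28)"
    "tri (k 19 21) (k 19 22) (k 19 27)" "tri (k 20 22) (k 20 23) (k 20 25)" "tri (k 21 16) (k 21 19) (k 21 23)"
    "tri (k 22 17) (k 22 19) (k 22 20)" "tri (k 23 18) (k 23 20) (k 23 21)"
    using t[of 16] t[of 17] t[of 18] t[of 19] t[of 20] t[of 21] t[of 22] t[of 23] by simp_all
  have h: "tri (k 24 11) (k 24 16) (k 24 26)" "tri (k 25 10) (k 25 20) (k 25 26)" "tri (k 26 24) (k 26 25) (k 26 30)"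
    "tri (k 27 0) (k 27 19) (k 27 29)" "tri (k 28 4) (k 28 18) (k 28 29)" "tri (k 29 27) (k 29 28) (k 29 30)"
    "tri (k 30 26) (k 30 29) (k 30 e)"
    using t[of 24] t[of 25] t[of 26] t[of 27] t[of 28] t[of 29] t[of 30] by simp_all
  note perm = tri_commute tri_commute(1)[OF tri_commute(2)] tri_commute(2)[OF tri_commute(1)]
  have c1: "core_ok (k 2 c) (k 3 a) (k 0 27) (k 4 28)"
    by (rule core_colouring[of "k 0 1" "k 1 2" "k 1 6" _ "k 0 5" _ "k 2 7" "k 4 7" "k 5 7" "k 3 5" "k 3 6" "k 4 6"])
      (use v sym in \<open>metis perm\<close>)+
  have c2: "core_ok (k 10 25) (k 11 24) (k 8 b) (k 12 d)"
    by (rule core_colouring[of "k 8 9" "k 9 10" "k 9 14" _ "k 8 13" _ "k 10 15" "k 12 15" "k 13 15" "k 11 13" "k 11 14" "k 12 14"])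
      (use v' sym in \<open>metis perm\<close>)+
  have c3: "core_ok (k 18 28) (k 19 27) (k 16 24) (k 20 25)"
    by (rule core_colouring[of "k 16 17" "k 17 18" "k 17 22" _ "k 16 21" _ "k 18 23" "k 20 23" "k 21 23" "k 19 21" "k 19 22" "k 20 22"])
      (use v'' sym in \<open>metis perm\<close>)+
  have m: "dbl (k 8 b) + dbl (k 12 d) \<in> set (dbl_sums (k 10 25) (k 11 24))"
    using c2 unfolding core_ok_def by blast
  have m': "dbl (k 2 c) + dbl (k 3 a) \<in> set (dbl_sums (k 0 27) (k 4 28))"
    using c1 unfolding core_ok_def by blast
  have "(k 26 30, dbl (k 8 b) + dbl (k 12 d)) \<in> set (hub_half (k 20 25) (k 16 24))"
    by (rule in_hub_half[OF _ _ _ m, of _ "k 25 26" _ "k 24 26"]) (use h sym in \<open>metis perm\<close>)+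
  moreover have "(k 29 30, dbl (k 2 c) + dbl (k 3 a)) \<in> set (hub_half (k 19 27) (k 18 28))"
    by (rule in_hub_half[OF _ _ _ m', of _ "k 27 29" _ "k 28 29"]) (use h sym in \<open>metis perm\<close>)+
  moreover have "tri (k 26 30) (k 29 30) (k 30 e)" using h(7) sym by metis
  ultimately have "dbl (k 8 b) + dbl (k 12 d) + (dbl (k 2 c) + dbl (k 3 a)) \<noteq> Suc (dbl (k 30 e))"
    using c3 hub_colouring unfolding core_ok_def by blast
  then show ?thesis by simp
qed

section \<open>The graph\<close>

text \<open>In the LCF cycle of length \<open>n - 28\<close> the removed path is
  \<open>n, n + 1, n + 2\<close>, congruent to 28, 29, 30. Its outer neighbours are
  \<open>n - 1\<close> and \<open>n - 5\<close>, then 34, then 31 and \<open>n - 3\<close>; these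
  carry the five edges to the windmill. The chord from \<open>n - 1\<close> wraps around to
  32.\<close>

definition chord :: "nat \<Rightarrow> nat \<Rightarrow> nat" where
  "chord n x =
    (if odd x then if x + 5 < n then x + 5 else if x + 5 = n then 8 else if x + 3 = n then 12 else 32
     else if x = 32 then n - 1 else if x = 34 then 30 else x - 5)"

text \<open>The vertices 31, 32, \<dots>, \<open>n - 1\<close> form the strip; odd and even vertices are its colour classes.\<close>

definition nb :: "nat \<Rightarrow> nat \<Rightarrow> nat list" where
  "nb n x =
    (if x < 31 then windmill (n - 1) (n - 5) 31 (n - 3) 34 ! x
     else [if x = 31 then 2 else x - 1, if x + 1 = n then 3 else x + 1, chord n x])"

lemma less_31_cases:
  "x < (31::nat) \<Longrightarrow> x \<in> {0, 1, 2, 3, 4, 5, 6, 7, 8, 9, 10, 11, 12, 13, 14, 15, 16, 17, 18, 19, 20,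
     21, 22, 23, 24, 25, 26, 27, 28, 29, 30}"
  by (simp; presburger)

section \<open>The windmill snark by edge insertions\<close>

definition windmill_edges :: "(nat \<times> nat) list" where
  "windmill_edges =
    [(0, 1), (0, 5), (0, 27), (1, 2), (1, 6), (2, 7), (3, 5), (3, 6), (4, 6), (4, 7), (4, 28), (5, 7),
     (8, 9), (8, 13), (9, 10), (9, 14), (10, 15), (10, 25), (11, 13), (11, 14), (11, 24), (12, 14), (12, 15), (13, 15),
     (16, 17), (16, 21), (16, 24), (17, 18), (17, 22), (18, 23), (18, 28), (19, 21), (19, 22), (19, 27), (20, 22), (20, 23),
     (20, 25), (21, 23), (24, 26), (25, 26), (26, 30), (27, 29), (28, 29), (29, 30)]"

text \<open>A sequence of insertions turning \<open>K\<^sub>4\<close> into the windmill snark; it was found by computer, removing edges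
  from the snark while all its cuts stay large.\<close>

definition windmill_steps :: "(nat \<times> nat \<times> nat \<times> nat \<times> nat \<times> nat) list" where
  "windmill_steps =
    [(28, 31, 24, 30, 7, 26), (7, 31, 24, 28, 0, 18), (7, 26, 30, 31, 32, 33), (24, 31, 32, 26, 11, 15),
     (24, 18, 15, 26, 17, 25), (11, 31, 15, 25, 9, 10), (0, 18, 17, 25, 19, 22), (32, 15, 11, 9, 12, 14),
     (0, 31, 7, 32, 1, 2), (0, 19, 28, 30, 27, 29), (1, 31, 7, 0, 3, 5), (28, 7, 1, 3, 4, 6),
     (9, 31, 11, 15, 8, 13), (24, 17, 19, 18, 16, 21), (22, 25, 21, 18, 20, 23)]"

text \<open>The path 31, 33, 32 restores the windmill snark of order 34.\<close>

definition closing_edges :: "(nat \<times> nat) list" where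
  "closing_edges = [(3, 31), (8, 31), (2, 32), (12, 32), (30, 33), (31, 33), (32, 33)]"

definition windmill_ok :: "nat list \<Rightarrow> (nat \<times> nat) list \<Rightarrow> (nat \<times> nat) list \<Rightarrow> bool" where
  "windmill_ok vs es fs \<longleftrightarrow> distinct es \<and> distinct fs \<and>
     list_all (\<lambda>p. p \<in> set fs) es \<and> list_all (\<lambda>p. p \<in> set es) fs \<and>
     list_all (\<lambda>x. x \<in> set vs) [0..<34] \<and> list_all (\<lambda>x. x < 34) vs"

definition windmill_check :: "(nat list \<times> (nat \<times> nat) list) option \<Rightarrow> bool" where
  "windmill_check st = (case st of None \<Rightarrow> False | Some (vs, es) \<Rightarrow>
     windmill_ok vs (map (\<lambda>(x, y). (min x y, max x y)) es) (windmill_edges @ closing_edges))"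

definition K4 :: "nat list \<times> (nat \<times> nat) list" where
  "K4 = ([24, 28, 30, 31], [(24, 28), (24, 30), (24, 31), (28, 30), (28, 31), (30, 31)])"

lemma windmill_check: "windmill_check (insert_edges windmill_steps K4)"
  by code_simp

lemma windmill_checkE:
  assumes "windmill_check st"
  obtains vs es where "st = Some (vs, es)" "set vs = {..<34}"
    "\<And>A. crossings (windmill_edges @ closing_edges) A = crossings es A"
proof -
  obtain vs es where st: "st = Some (vs, es)" using assms unfolding windmill_check_def by (cases st) auto
  have ok: "windmill_ok vs (map (\<lambda>(x, y). (min x y, max x y)) es) (windmill_edges @ closing_edges)"
    using assms unfolding windmill_check_def st option.case prod.case .
  have vs: "set vs = {..<34}"
  proof -
    have "\<forall>x\<in>set [0..<34]. x \<in> set vs" "\<forall>x\<in>set vs. x < 34"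
      using ok unfolding windmill_ok_def list_all_iff by blast+
    then show ?thesis unfolding set_upt by auto
  qed
  have eq: "crossings (windmill_edges @ closing_edges) A = crossings (map (\<lambda>(x, y). (min x y, max x y)) es) A" for A
    by (rule crossings_distinct) (use ok in \<open>unfold windmill_ok_def list_all_iff, blast+\<close>)
  show ?thesis by (rule that[OF st vs]) (simp only: eq crossings_flip)
qed

text \<open>A set inside the windmill misses 31, 32 and 33, so its complement in the snark of order
  34 is large enough for the bound of 4.\<close>

lemma windmill_crossings:
  assumes "A \<subseteq> {..<31}" "2 \<le> card A"
  shows "4 \<le> crossings (windmill_edges @ closing_edges) A"
proof -
  obtain vs es where run: "insert_edges windmill_steps K4 = Some (vs, es)" and vs: "set vs = {..<34}"
    and eq: "\<And>A. crossings (windmill_edges @ closing_edges) A = crossings es A"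
    by (rule windmill_checkE[OF windmill_check]) (rule that)
  have "essentially_4_edge_connected_list (fst K4) (snd K4)" unfolding K4_def fst_conv snd_conv by (rule essentially_4_edge_connected_list_K4) simp
  moreover have "insert_edges windmill_steps (fst K4, snd K4) = Some (vs, es)" using run by (simp only: prod.collapse)
  ultimately have g: "essentially_4_edge_connected_list vs es" by (rule essentially_4_edge_connected_list_insert_edges)
  have sub: "{31, 32, 33} \<subseteq> set vs - A" unfolding vs using assms(1) by auto
  then have "card {31, 32, 33::nat} \<le> card (set vs - A)" by (intro card_mono) auto
  then have "2 \<le> card (set vs - A)" by simp
  moreover have "A \<subseteq> set vs" unfolding vs using assms(1) by auto
  moreover have "A \<noteq> {}" using assms(2) by auto
  moreover have "A \<noteq> set vs" using sub by blast
  ultimately have "4 \<le> crossings es A" using g assms(2) unfolding essentially_4_edge_connected_list_def by blast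
  then show ?thesis unfolding eq .
qed

definition no_short_cycle :: "nat list list \<Rightarrow> nat \<Rightarrow> bool" where
  "no_short_cycle w a = list_all (\<lambda>b. list_all (\<lambda>c. a \<noteq> c \<longrightarrow>
     a \<notin> set (w ! c) \<and> list_all (\<lambda>d. b \<noteq> d \<longrightarrow> a \<notin> set (w ! d)) (filter (\<lambda>d. d < 31) (w ! c)))
     (filter (\<lambda>c. c < 31) (w ! b))) (filter (\<lambda>b. b < 31) (w ! a))"

text \<open>The dummy 31 for all outer ends makes the check independent of \<open>n\<close>; the
  filters discard it.\<close>

lemma no_short_cycle_windmill: "list_all (no_short_cycle (windmill 31 31 31 31 31)) [0..<31]"
  by code_simp

definition dsum :: "(nat \<Rightarrow> nat \<Rightarrow> label) \<Rightarrow> (nat \<times> nat) set \<Rightarrow> nat" where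
  "dsum k P = (\<Sum>(x, y)\<in>P. dbl (k x y))"

section \<open>The graph of order \<open>n\<close>: symmetry of its neighbour lists\<close>

context
  fixes n :: nat
  assumes even_n: "even n" and n42: "42 \<le> n"
begin

text \<open>This form of \<open>n\<close> lets the simplifier decide parities and comparisons of
  \<open>n - 5\<close> and the like with numerals.\<close>

lemma n_cases: obtains k where "n = 2 * k + 42"
  using even_n n42 by (metis add.commute dvd_def dvd_diff_nat le_add_diff_inverse even_numeral)

lemma nb_small: "x < 31 \<Longrightarrow> nb n x = windmill (n - 1) (n - 5) 31 (n - 3) 34 ! x"
  by (simp add: nb_def)

lemma nb_large: "31 \<le> x \<Longrightarrow> nb n x = [if x = 31 then 2 else x - 1, if x + 1 = n then 3 else x + 1, chord n x]"
  by (simp add: nb_def)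

lemma nb_lists_small:
  assumes "x < 31"
  shows "length (nb n x) = 3 \<and> distinct (nb n x) \<and> (\<forall>y\<in>set (nb n x). y < n \<and> y \<noteq> x \<and> x \<in> set (nb n y))"
proof -
  obtain k where n: "n = 2 * k + 42" by (rule n_cases)
  show ?thesis
    using less_31_cases[OF assms] unfolding n
    by (elim insertE emptyE; simp add: nb_def windmill_def chord_def)
qed

lemma nb_lists_large:
  assumes "31 \<le> x" "x < n"
  shows "length (nb n x) = 3 \<and> distinct (nb n x) \<and> (\<forall>y\<in>set (nb n x). y < n \<and> y \<noteq> x \<and> x \<in> set (nb n y))"
proof -
  obtain k where n: "n = 2 * k + 42" by (rule n_cases)
  have w: "31 \<in> set (nb n 2)" "n - 1 \<in> set (nb n 3)" "n - 5 \<in> set (nb n 8)" "n - 3 \<in> set (nb n 12)" "34 \<in> set (nb n 30)"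
    by (simp_all add: nb_def windmill_def)
  have left: "x - 1 < n \<and> x \<in> set (nb n (x - 1))" if "x \<noteq> 31"
    using that assms by (auto simp: nb_def)
  have right: "x + 1 < n \<and> x \<in> set (nb n (x + 1))" if "x + 1 \<noteq> n"
    using that assms by (auto simp: nb_def)
  have chd: "chord n x < n \<and> x \<in> set (nb n (chord n x))"
  proof (cases "odd x")
    case True
    \<comment> \<open>Only the last three odd vertices have an irregular chord.\<close>
    have "x + 5 < n \<or> x = n - 5 \<or> x = n - 3 \<or> x = n - 1"
      using True assms even_n by presburger
    then consider "x + 5 < n" | "x = n - 5" | "x = n - 3" | "x = n - 1" by blast
    then show ?thesis using True assms w n42 by cases (auto simp: nb_def chord_def)
  next
    case False
    have "x = 32 \<or> x = 34 \<or> 36 \<le> x" using False assms(1) by presburger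
    then consider "x = 32" | "x = 34" | "36 \<le> x" by blast
    then show ?thesis using False assms w even_n n42
    proof cases
      case 3
      then have "odd (x - 5)" using False by simp
      then show ?thesis using 3 False assms by (auto simp: nb_def chord_def)
    qed (auto simp: nb_def chord_def)
  qed
  have dist: "chord n x \<noteq> x" "chord n x \<noteq> (if x = 31 then 2 else x - 1)" "chord n x \<noteq> (if x + 1 = n then 3 else x + 1)"
    using assms n42 even_n unfolding chord_def by (auto split: if_splits)
  show ?thesis
    using left right chd w assms n42 dist unfolding nb_large[OF assms(1)] by (auto split: if_splits)
qed

lemma nbr_lists_nb: "nbr_lists n (nb n)"
  unfolding nbr_lists_def using nb_lists_small nb_lists_large not_less by blast

section \<open>Counting double edges in the strip\<close>

text \<open>Each vertex of the strip lies on exactly one double edge. Double edges inside the strip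
  are counted once from each colour class, and the odd class has one more vertex than the even
  class, so the outer edges make up the difference.\<close>

lemma bipartite_count:
  assumes sym: "\<And>x y. k x y = (k y x :: label)"
    and tri: "\<And>x p q r. 31 \<le> x \<Longrightarrow> x < n \<Longrightarrow> nb n x = [p, q, r] \<Longrightarrow> tri (k x p) (k x q) (k x r)"
  shows "dbl (k 2 31) + dbl (k 3 (n - 1)) + dbl (k 8 (n - 5)) + dbl (k 12 (n - 3)) = Suc (dbl (k 30 34))"
proof -
  obtain j where n: "n = 2 * j + 42" by (rule n_cases)
  define Ev where "Ev = {x. even x \<and> 31 \<le> x \<and> x < n}"
  define Od where "Od = {x. odd x \<and> 31 \<le> x \<and> x < n}"
  \<comment> \<open>The edges inside the strip, directed from their even ends.\<close>
  define I where "I = {(x, y). x \<in> Ev \<and> y \<in> set (nb n x) \<and> 31 \<le> y}"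
  have fin: "finite Ev" "finite Od" unfolding Ev_def Od_def by simp_all
  have one: "(\<Sum>y\<in>set (nb n x). dbl (k x y)) = 1" if x: "31 \<le> x" "x < n" for x
  proof -
    obtain p q r where l: "nb n x = [p, q, r]" using nb_large[OF x(1)] by blast
    have "distinct [p, q, r]" using nb_lists_large[OF x] l by simp
    then show ?thesis using dbl_tri[OF tri[OF x l]] l by simp
  qed
  have total: "dsum k (Sigma S (\<lambda>x. set (nb n x))) = card S" if "finite S" "S \<subseteq> {31..<n}" for S
  proof -
    have "dsum k (Sigma S (\<lambda>x. set (nb n x))) = (\<Sum>x\<in>S. \<Sum>y\<in>set (nb n x). dbl (k x y))"
      unfolding dsum_def using that(1) by (subst sum.Sigma) auto
    also have "\<dots> = (\<Sum>x\<in>S. 1)" by (intro sum.cong refl one) (use that(2) in auto)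
    finally show ?thesis by simp
  qed
  have E: "Sigma Ev (\<lambda>x. set (nb n x)) = insert (34, 30) I"
    unfolding I_def Ev_def n by (auto simp: nb_def chord_def split: if_splits; presburger)
  have O: "Sigma Od (\<lambda>x. set (nb n x)) = {(31, 2), (n - 1, 3), (n - 5, 8), (n - 3, 12)} \<union> prod.swap ` I" (is "?L = ?R")
  proof
    have odd': "even y" if "x \<in> Od" "y \<in> set (nb n x)" "31 \<le> y" for x y
      using that unfolding Od_def n by (auto simp: nb_def chord_def split: if_splits)
    have ev': "odd y" if "x \<in> Ev" "y \<in> set (nb n x)" "31 \<le> y" for x y
      using that unfolding Ev_def n by (auto simp: nb_def chord_def split: if_splits)
    have out: "(x, y) \<in> {(31, 2), (n - 1, 3), (n - 5, 8), (n - 3, 12)}" if "x \<in> Od" "y \<in> set (nb n x)" "y < 31" for x y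
      using that unfolding Od_def n by (auto simp: nb_def chord_def split: if_splits)
    show "?L \<subseteq> ?R"
    proof
      fix p assume "p \<in> ?L"
      then obtain x y where p: "p = (x, y)" "x \<in> Od" "y \<in> set (nb n x)" by blast
      show "p \<in> ?R"
      proof (cases "31 \<le> y")
        case True
        then have "y < n" "x \<in> set (nb n y)" "even y" using nb_lists_large[of x] p odd' unfolding Od_def by blast+
        then have "(y, x) \<in> I" using True p unfolding I_def Ev_def Od_def by simp
        then show ?thesis unfolding p by (metis UnI2 image_eqI swap_simp)
      next
        case False
        then have "y < 31" by simp
        from out[OF p(2,3) this] show ?thesis unfolding p(1) by (rule UnI1)
      qed
    qed
    have "(y, x) \<in> ?L" if "(x, y) \<in> I" for x y
      using that nb_lists_large[of x] ev'[of x y] unfolding I_def Ev_def Od_def by auto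
    moreover have "{(31, 2), (n - 1, 3), (n - 5, 8), (n - 3, 12)} \<subseteq> ?L"
      unfolding Od_def n by (simp add: nb_def chord_def)
    ultimately show "?R \<subseteq> ?L" by auto
  qed
  have finI: "finite I" using E fin by (metis finite_SigmaI finite_insert List.finite_set)
  have "(34, 30) \<notin> I" unfolding I_def by simp
  then have cE: "card Ev = dbl (k 34 30) + dsum k I"
  proof -
    have "Ev \<subseteq> {31..<n}" unfolding Ev_def by auto
    from total[OF fin(1) this] show ?thesis using finI \<open>(34, 30) \<notin> I\<close> unfolding E dsum_def by simp
  qed
  have "{(31, 2), (n - 1, 3), (n - 5, 8), (n - 3, 12)} \<inter> prod.swap ` I = {}" unfolding I_def Ev_def by auto
  then have "dsum k (Sigma Od (\<lambda>x. set (nb n x))) =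
      dsum k {(31, 2), (n - 1, 3), (n - 5, 8), (n - 3, 12)} + dsum k (prod.swap ` I)"
    unfolding O dsum_def using finI by (intro sum.union_disjoint) auto
  moreover have "dsum k (prod.swap ` I) = dsum k I"
    unfolding dsum_def by (subst sum.reindex) (auto simp: sym intro!: sum.cong)
  moreover have "dsum k {(31, 2), (n - 1, 3), (n - 5, 8), (n - 3, 12)} =
      dbl (k 31 2) + dbl (k (n - 1) 3) + dbl (k (n - 5) 8) + dbl (k (n - 3) 12)"
    unfolding dsum_def using n42 by simp
  moreover have "dsum k (Sigma Od (\<lambda>x. set (nb n x))) = card Od"
    by (rule total[OF fin(2)]) (auto simp: Od_def)
  \<comment> \<open>The strip begins and ends with an odd vertex.\<close>
  moreover have "Od = insert 31 (Suc ` Ev)"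
  proof (intro equalityI subsetI)
    fix x assume x: "x \<in> Od"
    show "x \<in> insert 31 (Suc ` Ev)"
    proof (cases "x = 31")
      case False
      then have "x - 1 \<in> Ev" "x = Suc (x - 1)" using x unfolding Od_def Ev_def by auto
      then show ?thesis by blast
    qed simp
  next
    fix x assume "x \<in> insert 31 (Suc ` Ev)"
    then show "x \<in> Od" using n42 even_n unfolding Od_def Ev_def by (auto; presburger)
  qed
  moreover have "31 \<notin> Suc ` Ev" unfolding Ev_def by auto
  ultimately show ?thesis using cE fin(1)
    sym[of 2 31] sym[of 3 "n - 1"] sym[of 8 "n - 5"] sym[of 12 "n - 3"] sym[of 30 34]
    by (simp add: card_image)
qed

lemma not_four_coverable: "\<not> four_coverable {..<n} (nbr_graph n (nb n))"
proof
  assume "four_coverable {..<n} (nbr_graph n (nb n))"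
  then obtain k :: "nat \<Rightarrow> nat \<Rightarrow> label" where sym: "\<And>x y. k x y = k y x"
    and tri: "\<And>x a b c. x < n \<Longrightarrow> nb n x = [a, b, c] \<Longrightarrow> tri (k x a) (k x b) (k x c)"
    using nbr_graph_colouring[OF nbr_lists_nb] by metis
  have "dbl (k 2 31) + dbl (k 3 (n - 1)) + dbl (k 8 (n - 5)) + dbl (k 12 (n - 3)) \<noteq> Suc (dbl (k 30 34))"
    by (rule windmill_colouring[of k, OF sym]) (use tri nb_small n42 in auto)
  then show False using bipartite_count[of k] sym tri by auto
qed

section \<open>Cuts of sets inside the windmill or inside the strip\<close>

lemma windmill_cut:
  assumes A: "A \<subseteq> {..<31}" "2 \<le> card A"
  shows "4 \<le> card (edge_cut (nbr_graph n (nb n)) A)"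
proof -
  define ws where "ws = [(3, n - 1), (8, n - 5), (2, 31), (12, n - 3), (30::nat, 34::nat)]"
  define es where "es = windmill_edges @ ws"
  define f where "f = filter (\<lambda>(x, y). (x \<in> A) \<noteq> (y \<in> A)) es"
  have out: "x \<notin> A" if "31 \<le> x" for x using A(1) that by auto
  \<comment> \<open>The outer ends lie outside \<open>A\<close> in both lists, and the path 31, 33,
    32 is not cut.\<close>
  have "crossings closing_edges A = crossings ws A"
    unfolding ws_def closing_edges_def crossings_def using n42 by (simp add: out)
  then have "4 \<le> crossings es A"
    using windmill_crossings[OF A] unfolding es_def by (simp add: crossings_append)
  moreover have "distinct es" 
  proof -
    obtain k where "n = 2 * k + 42" by (rule n_cases)
    then show ?thesis unfolding es_def windmill_edges_def ws_def by simp
  qed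
  ultimately have 4: "4 \<le> card (set f)"
    using distinct_card[of f] unfolding f_def crossings_def by simp
  have "list_all (\<lambda>(x, y). x < y \<and> x < n \<and> y \<in> set (nb n x)) es"
  proof -
    obtain k where "n = 2 * k + 42" by (rule n_cases)
    then show ?thesis unfolding es_def windmill_edges_def ws_def by (simp add: nb_def windmill_def)
  qed
  then have es: "x < y \<and> x < n \<and> y \<in> set (nb n x)" if "(x, y) \<in> set es" for x y
    using that unfolding list_all_iff by blast
  \<comment> \<open>Cut edges are directed out of \<open>A\<close>; as listed pairs are increasing,
    distinct ones stay distinct.\<close>
  define P where "P = (\<lambda>(x, y). if x \<in> A then (x, y) else (y, x)) ` set f"
  have "card P = card (set f)" unfolding P_def
  proof (rule card_image, rule inj_onI, clarify)
    fix x y x' y' assume "(x, y) \<in> set f" "(x', y') \<in> set f"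
      and eq: "(if x \<in> A then (x, y) else (y, x)) = (if x' \<in> A then (x', y') else (y', x'))"
    then have "x < y" "x' < y'" using es unfolding f_def by auto
    then show "x = x' \<and> y = y'" using eq by (auto split: if_splits)
  qed
  moreover have "card P \<le> card (edge_cut (nbr_graph n (nb n)) A)"
  proof (rule nbr_graph_cut_ge[OF nbr_lists_nb])
    show "A \<subseteq> {..<n}" using A(1) n42 by auto
    fix x y assume "(x, y) \<in> P"
    then consider "(x, y) \<in> set es" "x \<in> A" "y \<notin> A" | "(y, x) \<in> set es" "x \<in> A" "y \<notin> A"
      unfolding P_def f_def by (auto split: if_splits)
    then show "x \<in> A \<and> y \<in> set (nb n x) \<and> y \<notin> A"
    proof cases
      case 2
      then show ?thesis using es[of y x] nbr_listsD(5)[OF nbr_lists_nb, of y x] by blast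
    qed (use es in blast)
  qed
  ultimately show ?thesis using 4 by linarith
qed

text \<open>The first and last vertices of \<open>A\<close> each have a path edge leaving
  \<open>A\<close>. A gap in \<open>A\<close> contributes two more; if \<open>A\<close> is an
  interval, two chords or edges to the windmill do.\<close>

lemma strip_cut:
  assumes A: "A \<subseteq> {31..<n}" "2 \<le> card A"
  shows "4 \<le> card (edge_cut (nbr_graph n (nb n)) A)"
proof -
  have fin: "finite A" using A(1) finite_subset by blast
  have ne: "A \<noteq> {}" using A(2) by auto
  define s where "s = Min A"
  define t where "t = Max A"
  have s: "s \<in> A" "\<And>x. x \<in> A \<Longrightarrow> s \<le> x" unfolding s_def using fin ne by auto
  have t: "t \<in> A" "\<And>x. x \<in> A \<Longrightarrow> x \<le> t" unfolding t_def using fin ne by auto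
  have rng: "31 \<le> x" "x < n" if "x \<in> A" for x using A(1) that by auto
  have st: "s < t"
  proof (rule ccontr)
    assume "\<not> s < t"
    then have "A \<subseteq> {s}" using s(2) t(2) by (metis insertI1 le_antisym not_less order_trans subsetI)
    then show False using A(2) card_mono[of "{s}" A] by simp
  qed
  have small: "y \<notin> A" if "y < 31" for y using rng that by (meson not_less)
  have main: "4 \<le> card (edge_cut (nbr_graph n (nb n)) A)"
    if P: "card P = 4" "\<And>x y. (x, y) \<in> P \<Longrightarrow> x \<in> A \<and> y \<in> set (nb n x) \<and> y \<notin> A" for P :: "(nat \<times> nat) set"
  proof -
    have "A \<subseteq> {..<n}" using A(1) by auto
    from nbr_graph_cut_ge[OF nbr_lists_nb this, of P] P show ?thesis by simp
  qed
  define l where "l = (if s = 31 then 2 else s - 1)"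
  define r where "r = (if t + 1 = n then 3 else t + 1)"
  have l: "l \<in> set (nb n s)" "l \<notin> A" "l < s"
    using rng[OF s(1)] s(2)[of l] small[of l] unfolding l_def by (auto simp: nb_def split: if_splits)
  have r: "r \<in> set (nb n t)" "r \<notin> A" "r < 31 \<or> r = t + 1"
    using rng[OF t(1)] t(2)[of r] small[of r] unfolding r_def by (auto simp: nb_def split: if_splits)
  show ?thesis
  proof (cases "\<exists>p. p \<in> A \<and> p + 1 \<notin> A \<and> p < t")
    case True
    then obtain p where p: "p \<in> A" "p + 1 \<notin> A" "p < t" by blast
    \<comment> \<open>The first vertex of \<open>A\<close> after the gap that starts at
      \<open>p + 1\<close>.\<close>
    define q where "q = Min {x \<in> A. p < x}"
    have "q \<in> {x \<in> A. p < x}" unfolding q_def using fin t(1) p(3) by (intro Min_in) auto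
    then have q: "q \<in> A" "p < q" by auto
    have q': "q \<le> x" if "x \<in> A" "p < x" for x unfolding q_def using fin that by (intro Min_le) auto
    have "q - 1 \<notin> A"
    proof
      assume q1: "q - 1 \<in> A"
      have "q \<noteq> p + 1" using q p by blast
      then have "p < q - 1" using q by linarith
      then show False using q'[OF q1] by linarith
    qed
    moreover have "q \<noteq> 31" "p + 1 \<noteq> n" using rng p q t(1) by fastforce+
    ultimately have "q - 1 \<in> set (nb n q)" "p + 1 \<in> set (nb n p)" "q - 1 \<notin> A"
      using rng[OF p(1)] rng[OF q(1)] by (auto simp: nb_def)
    moreover have "card {(s, l), (t, r), (p, p + 1), (q, q - 1)} = 4"
      using s(2)[OF p(1)] t(2)[OF q(1)] p(3) q(2) st l(3) r(3) rng[OF p(1)] rng[OF t(1)]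
      by (auto simp: card_insert_if)
    ultimately show ?thesis
    proof (intro main[of "{(s, l), (t, r), (p, p + 1), (q, q - 1)}"])
      fix x y assume "(x, y) \<in> {(s, l), (t, r), (p, p + 1), (q, q - 1)}"
      then consider "x = s" "y = l" | "x = t" "y = r" | "x = p" "y = p + 1" | "x = q" "y = q - 1" by blast
      then show "x \<in> A \<and> y \<in> set (nb n x) \<and> y \<notin> A"
        using l(1,2) r(1,2) s(1) t(1) p(1,2) q(1) \<open>q - 1 \<in> set (nb n q)\<close> \<open>p + 1 \<in> set (nb n p)\<close> \<open>q - 1 \<notin> A\<close>
        by cases simp_all
    qed
  next
    case False
    have iv: "x \<in> A \<longleftrightarrow> s \<le> x \<and> x \<le> t" for x
    proof
      assume "s \<le> x \<and> x \<le> t"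
      then have "s \<le> x" "x \<le> t" by auto
      then show "x \<in> A"
      proof (induction x rule: dec_induct)
        case (step m)
        then show ?case using False by (metis Suc_eq_plus1 Suc_leD Suc_le_eq)
      qed (rule s(1))
    qed (use s t in blast)
    show ?thesis
    proof (cases "s \<le> 32 \<and> t = n - 1")
      case True
      \<comment> \<open>Here the chord between 32 and \<open>n - 1\<close> may stay inside
        \<open>A\<close>, so four edges to the windmill are taken.\<close>
      have "card {(n - 1, 3), (n - 5, 8), (n - 3, 12), (34::nat, 30::nat)} = 4" using n42 by auto
      moreover have "n - 1 \<in> A" "n - 5 \<in> A" "n - 3 \<in> A" "34 \<in> A" unfolding iv using True n42 by auto
      moreover have "3 \<in> set (nb n (n - 1))" "8 \<in> set (nb n (n - 5))" "12 \<in> set (nb n (n - 3))" "30 \<in> set (nb n 34)"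
        using n42 even_n by (auto simp: nb_def chord_def)
      moreover have "3 \<notin> A" "8 \<notin> A" "12 \<notin> A" "30 \<notin> A" using small by auto
      ultimately show ?thesis
      proof (intro main[of "{(n - 1, 3), (n - 5, 8), (n - 3, 12), (34, 30)}"])
        fix x y :: nat assume xy: "(x, y) \<in> {(n - 1, 3), (n - 5, 8), (n - 3, 12), (34, 30)}"
          and A: "n - 1 \<in> A" "n - 5 \<in> A" "n - 3 \<in> A" "34 \<in> A" "3 \<notin> A" "8 \<notin> A" "12 \<notin> A" "30 \<notin> A"
          and N: "(3::nat) \<in> set (nb n (n - 1))" "8 \<in> set (nb n (n - 5))" "12 \<in> set (nb n (n - 3))" "30 \<in> set (nb n 34)"
        from xy show "x \<in> A \<and> y \<in> set (nb n x) \<and> y \<notin> A" by (elim insertE emptyE Pair_inject) (simp_all only: A N simp_thms)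
      qed
    next
      case F: False
      \<comment> \<open>The first even and the last odd vertex of the interval are so close to its
        ends that regular chords, of length 5, leave it; the chord between 32 and
        \<open>n - 1\<close> leaves it by the case assumption.\<close>
      define u where "u = (if even s then s else s + 1)"
      define v where "v = (if odd t then t else t - 1)"
      have u: "even u" "s \<le> u" "u \<le> s + 1" "u \<le> t" and v: "odd v" "t \<le> v + 1" "v \<le> t" "s \<le> v"
        using st unfolding u_def v_def by (auto elim!: oddE)
      have uA: "u \<in> A" and vA: "v \<in> A" unfolding iv using u v by auto
      have cu: "chord n u \<in> set (nb n u)" and cv: "chord n v \<in> set (nb n v)"
        using rng[OF uA] rng[OF vA] by (auto simp: nb_def)
      have cuA: "chord n u \<notin> A"
      proof -
        have "u = 32 \<or> u = 34 \<or> 36 \<le> u" using u(1) rng[OF uA] by presburger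
        then show ?thesis using u F rng[OF t(1)] unfolding iv chord_def by (elim disjE) auto
      qed
      have cvA: "chord n v \<notin> A"
      proof -
        have "v + 5 < n \<or> v + 5 = n \<or> v + 3 = n \<or> v + 1 = n" using v(1) rng[OF vA] even_n by presburger
        then show ?thesis using v F rng[OF t(1)] rng[OF s(1)] unfolding iv chord_def by (elim disjE) auto
      qed
      have "(s, l) \<noteq> (u, chord n u)"
        using u rng[OF s(1)] n42 unfolding l_def chord_def by (auto split: if_splits)
      moreover have "(t, r) \<noteq> (v, chord n v)"
        using v rng[OF t(1)] n42 unfolding r_def chord_def by (auto split: if_splits)
      moreover have "(s, l) \<noteq> (v, chord n v)"
        using v rng[OF s(1)] n42 even_n unfolding l_def chord_def by (auto split: if_splits)
      moreover have "(t, r) \<noteq> (u, chord n u)"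
        using u rng[OF t(1)] n42 even_n unfolding r_def chord_def by (auto split: if_splits)
      moreover have "u \<noteq> v" using u(1) v(1) by auto
      ultimately have "card {(s, l), (t, r), (u, chord n u), (v, chord n v)} = 4"
        using st by auto
      then show ?thesis
      proof (intro main[of "{(s, l), (t, r), (u, chord n u), (v, chord n v)}"])
        fix x y assume "(x, y) \<in> {(s, l), (t, r), (u, chord n u), (v, chord n v)}"
        then consider "x = s" "y = l" | "x = t" "y = r" | "x = u" "y = chord n u" | "x = v" "y = chord n v" by blast
        then show "x \<in> A \<and> y \<in> set (nb n x) \<and> y \<notin> A"
          using l(1,2) r(1,2) s(1) t(1) cu cv cuA cvA uA vA by cases simp_all
      qed
    qed
  qed
qed

section \<open>Girth\<close>

lemma wire:
  assumes "x < 31" "31 \<le> y" "y \<in> set (nb n x)"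
  shows "(x, y) \<in> {(3, n - 1), (8, n - 5), (2, 31), (12, n - 3), (30, 34)}"
  using less_31_cases[OF assms(1)] assms(2,3)
  by (elim insertE emptyE; simp add: nb_def windmill_def)

lemma windmill_nbr:
  assumes "x < 31" "y < 31" "y \<in> set (nb n x)"
  shows "y \<in> set (windmill 31 31 31 31 31 ! x)"
  using less_31_cases[OF assms(1)] assms(2,3) n42
  by (elim insertE emptyE; auto simp: nb_def windmill_def)

lemma strip_nbr:
  assumes "31 \<le> x" "x < n" "31 \<le> y" "y \<in> set (nb n x)"
  shows "if even x then odd y \<and> (y + 1 = x \<or> y = x + 1 \<or> y + 5 = x \<or> x = 32 \<and> y + 1 = n)
    else even y \<and> (x + 1 = y \<or> x = y + 1 \<or> x + 5 = y \<or> y = 32 \<and> x + 1 = n)"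
proof -
  have "odd x \<Longrightarrow> x + 5 < n \<or> x + 5 = n \<or> x + 3 = n \<or> x + 1 = n" using assms(2) even_n by presburger
  then show ?thesis using assms even_n n42 unfolding nb_large[OF assms(1)]
    by (auto simp: chord_def split: if_splits)
qed

text \<open>Short cycles in the windmill are excluded by evaluation, those in the strip by parity
  and differences. A cycle through both parts uses two of the independent connecting edges, and
  having length at most 4 it would need their strip ends to be adjacent.\<close>

lemma girth_nb: "5 \<le> girth (nbr_graph n (nb n))"
proof (rule girth_ge_5)
  note e = nbr_graph_edge_iff[OF nbr_lists_nb]
  note symD = nbr_listsD(5)[OF nbr_lists_nb]
  have adj_lt: "y < n" if "x < n" "y \<in> set (nb n x)" for x y using nbr_listsD(3)[OF nbr_lists_nb that] .
  define R where "R x y \<longleftrightarrow> x < n \<and> y \<in> set (nb n x)" for x y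
  have R_sym: "R x y \<Longrightarrow> R y x" for x y unfolding R_def using symD adj_lt by blast
  have eR: "{x, y} \<in> nbr_graph n (nb n) \<longleftrightarrow> R x y" for x y unfolding R_def by (rule e)
  have R_irr: "\<not> R x x" for x unfolding R_def using nbr_listsD(4)[OF nbr_lists_nb] by blast
  have wireR: "(x, y) \<in> {(3, n - 1), (8, n - 5), (2, 31), (12, n - 3), (30, 34)}" if "R x y" "x < 31" "31 \<le> y" for x y
    using wire that unfolding R_def by blast
  have w1: "y = y'" if "R x y" "R x y'" "x < 31" "31 \<le> y" "31 \<le> y'" for x y y'
    using wireR[OF that(1,3,4)] wireR[OF that(2,3,5)] by auto
  have w2: "x = x'" if "R x y" "R x' y" "x < 31" "x' < 31" "31 \<le> y" for x x' y
    using wireR[OF that(1,3,5)] wireR[OF that(2,4,5)] n42 by auto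
  have strip: "if even x then odd y \<and> (y + 1 = x \<or> y = x + 1 \<or> y + 5 = x \<or> x = 32 \<and> y + 1 = n)
    else even y \<and> (x + 1 = y \<or> x = y + 1 \<or> x + 5 = y \<or> y = 32 \<and> x + 1 = n)"
    if "R x y" "31 \<le> x" "31 \<le> y" for x y
    using strip_nbr that unfolding R_def by blast
  \<comment> \<open>Of these ends only 34 is even, and its neighbours in the strip are 33 and
    35.\<close>
  have w3: "\<not> R y y'" if "R x y" "R x' y'" "x < 31" "x' < 31" "31 \<le> y" "31 \<le> y'" for x y x' y'
  proof
    assume R: "R y y'"
    obtain k where n: "n = 2 * k + 42" by (rule n_cases)
    have "y \<in> {n - 1, n - 5, 31, n - 3, 34}" "y' \<in> {n - 1, n - 5, 31, n - 3, 34}"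
      using wireR[OF that(1,3,5)] wireR[OF that(2,4,6)] by auto
    then show False using strip[OF R that(5,6)] unfolding n by (elim insertE emptyE; simp; presburger)
  qed
  have small: "no_short_cycle (windmill 31 31 31 31 31) x" if "x < 31" for x
    using no_short_cycle_windmill that by (simp add: list_all_iff)
  have short: "\<forall>b\<in>set (filter (\<lambda>b. b < 31) (windmill 31 31 31 31 31 ! x)).
      \<forall>c\<in>set (filter (\<lambda>c. c < 31) (windmill 31 31 31 31 31 ! b)). x \<noteq> c \<longrightarrow>
        x \<notin> set (windmill 31 31 31 31 31 ! c) \<and>
        (\<forall>d\<in>set (filter (\<lambda>d. d < 31) (windmill 31 31 31 31 31 ! c)). b \<noteq> d \<longrightarrow> x \<notin> set (windmill 31 31 31 31 31 ! d))"
    if "x < 31" for x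
    using small[OF that] unfolding no_short_cycle_def list_all_iff .
  have wR: "y \<in> set (filter (\<lambda>y. y < 31) (windmill 31 31 31 31 31 ! x))" if "R x y" "x < 31" "y < 31" for x y
    using windmill_nbr that unfolding R_def by simp
  show False if "{a, b} \<in> nbr_graph n (nb n)" "{b, c} \<in> nbr_graph n (nb n)" "{c, a} \<in> nbr_graph n (nb n)" for a b c
  proof -
    have r: "R a b" "R b c" "R c a" using that unfolding eR by blast+
    then have ne: "a \<noteq> c" "a \<noteq> b" "b \<noteq> c" using R_irr by blast+
    have r': "R b a" "R c b" "R a c" using r R_sym by blast+
    show False
    proof (cases "a < 31 \<and> b < 31 \<and> c < 31")
      case True
      then have "a \<notin> set (windmill 31 31 31 31 31 ! c)"
        using short[of a] wR[OF r(1)] wR[OF r(2)] ne(1) by blast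
      then show False using wR[OF r(3)] True by simp
    next
      case False
      have "\<not> (31 \<le> a \<and> 31 \<le> b \<and> 31 \<le> c)"
      proof
        assume "31 \<le> a \<and> 31 \<le> b \<and> 31 \<le> c"
        then show False using strip[OF r(1)] strip[OF r(2)] strip[OF r(3)]
          by (cases "even a"; cases "even b"; cases "even c") simp_all
      qed
      moreover have "a < 31 \<or> 31 \<le> a" "b < 31 \<or> 31 \<le> b" "c < 31 \<or> 31 \<le> c" by linarith+
      ultimately show False
        using False r r' ne w1[of a b c] w1[of b a c] w1[of c a b] w2[of a c b] w2[of a b c] w2[of b a c] by blast
    qed
  qed
  have four: False if R: "R a b" "R b c" "R c d" "R d a" and ne: "a \<noteq> c" "b \<noteq> d"
    and ge: "31 \<le> a" "31 \<le> b" "31 \<le> c" "31 \<le> d" and ev: "even a" for a b c d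
  proof -
    have p: "odd b" "even c" "odd d" using strip[OF R(1)] strip[OF R(2)] strip[OF R(4)] ev ge by (auto split: if_splits)
    have lt: "a < n" "b < n" "c < n" "d < n" using R unfolding R_def by blast+
    have "b + 1 = a \<or> b = a + 1 \<or> b + 5 = a \<or> a = 32 \<and> b + 1 = n"
      "b + 1 = c \<or> b = c + 1 \<or> b + 5 = c \<or> c = 32 \<and> b + 1 = n"
      "d + 1 = c \<or> d = c + 1 \<or> d + 5 = c \<or> c = 32 \<and> d + 1 = n"
      "d + 1 = a \<or> d = a + 1 \<or> d + 5 = a \<or> a = 32 \<and> d + 1 = n"
      using strip[OF R(1)] strip[OF R(2)] strip[OF R(3)] strip[OF R(4)] p ev ge by simp_all
    then show False using ne n42 ge lt by (elim disjE conjE; linarith)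
  qed
  show False if "{a, b} \<in> nbr_graph n (nb n)" "{b, c} \<in> nbr_graph n (nb n)" "{c, d} \<in> nbr_graph n (nb n)"
    "{d, a} \<in> nbr_graph n (nb n)" "a \<noteq> c" "b \<noteq> d" for a b c d
  proof -
    have r: "R a b" "R b c" "R c d" "R d a" using that unfolding eR by blast+
    have r': "R b a" "R c b" "R d c" "R a d" using r R_sym by blast+
    show False
    proof (cases "a < 31 \<and> b < 31 \<and> c < 31 \<and> d < 31")
      case True
      then have "a \<notin> set (windmill 31 31 31 31 31 ! d)"
        using short[of a] wR[OF r(1)] wR[OF r(2)] wR[OF r(3)] that(5,6) by blast
      then show False using wR[OF r(4)] True by simp
    next
      case False
      show False
      proof (cases "31 \<le> a \<and> 31 \<le> b \<and> 31 \<le> c \<and> 31 \<le> d")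
        case True
        show False
        proof (cases "even a")
          case ev: True
          show False using four[OF r that(5,6)] True ev by blast
        next
          case False
          then have "even b" using strip[OF r(1)] True by simp
          \<comment> \<open>Rotating the cycle by one puts an even vertex first.\<close>
          then show False using four[OF r(2,3,4,1)] True that(5,6) by metis
        qed
      next
        case F: False
        have "a < 31 \<or> 31 \<le> a" "b < 31 \<or> 31 \<le> b" "c < 31 \<or> 31 \<le> c" "d < 31 \<or> 31 \<le> d" by linarith+
        then show False
          using F False r r' that(5,6) w1[of a b d] w1[of b a c] w1[of c b d] w1[of d c a]
            w2[of a b c] w2[of b c d] w2[of a d c] w2[of d a b]
            w3[of a b d c] w3[of a d b c] w3[of b a c d] w3[of c b d a] by blast
      qed
    qed
  qed
qed

section \<open>Connectivity of the whole graph\<close>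

lemma crossing_edges:
  "edge_cut (nbr_graph n (nb n)) {..<31} \<subseteq> (\<lambda>(x, y). {x, y}) ` {(3, n - 1), (8, n - 5), (2, 31), (12, n - 3), (30, 34)}"
proof
  fix e assume "e \<in> edge_cut (nbr_graph n (nb n)) {..<31}"
  then have e: "e \<in> nbr_graph n (nb n)" "e \<inter> {..<31} \<noteq> {}" "\<not> e \<subseteq> {..<31}" unfolding edge_cut_def by auto
  obtain a b where ab: "e = {a, b}" using simple_graph_edgeE[OF nbr_graph_simple[OF nbr_lists_nb] e(1)] by metis
  obtain x y where xy: "e = {x, y}" "x < 31" "31 \<le> y"
  proof (cases "a < 31")
    case True
    then show thesis using that[of a b] ab e(3) by auto
  next
    case False
    then show thesis using that[of b a] ab e(2) by (auto simp: insert_commute)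
  qed
  then have "y \<in> set (nb n x)" using e(1) nbr_graph_edge_iff[OF nbr_lists_nb] by blast
  then have "(x, y) \<in> {(3, n - 1), (8, n - 5), (2, 31), (12, n - 3), (30, 34)}" using wire xy by blast
  then show "e \<in> (\<lambda>(x, y). {x, y}) ` {(3, n - 1), (8, n - 5), (2, 31), (12, n - 3), (30, 34)}"
    unfolding xy(1) by (rule rev_image_eqI) simp
qed

lemma essentially_4_edge_connected_nb: "essentially_4_edge_connected {..<n} (nbr_graph n (nb n))"
proof (rule essentially_4_edge_connected_glue[OF nbr_graph_simple[OF nbr_lists_nb], of "{..<31}" "{31..<n}"])
  let ?X = "(\<lambda>(x, y). {x, y}) ` {(3, n - 1), (8, n - 5), (2, 31), (12, n - 3), (30, 34)}"
  show "{..<n} = {..<31} \<union> {31..<n}" "{..<31} \<inter> {31..<n} = {}" using n42 by auto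
  have "card ?X \<le> card {(3, n - 1), (8, n - 5), (2, 31), (12, n - 3), (30::nat, 34::nat)}" by (intro card_image_le) simp
  also have "\<dots> \<le> 5" using n42 by (simp add: card_insert_if)
  finally have "card ?X \<le> 5" .
  moreover have "card (edge_cut (nbr_graph n (nb n)) {..<31}) \<le> card ?X" by (rule card_mono[OF _ crossing_edges]) simp
  ultimately show "card (edge_cut (nbr_graph n (nb n)) {..<31}) \<le> 5" by linarith
  show "card {e \<in> edge_cut (nbr_graph n (nb n)) {..<31}. x \<in> e} \<le> 1" for x
  proof -
    obtain k where n: "n = 2 * k + 42" by (rule n_cases)
    \<comment> \<open>The connecting edges are independent, so a vertex determines the one it lies
      on.\<close>
    have "p = (if x = 3 \<or> x = n - 1 then (3, n - 1) else if x = 8 \<or> x = n - 5 then (8, n - 5)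
        else if x = 2 \<or> x = 31 then (2, 31) else if x = 12 \<or> x = n - 3 then (12, n - 3) else (30, 34))"
      if "p \<in> {(3, n - 1), (8, n - 5), (2, 31), (12, n - 3), (30, 34)}" "x = fst p \<or> x = snd p" for p
      using that unfolding n by (elim insertE emptyE disjE; simp)
    then have pq: "p = q" if "p \<in> {(3, n - 1), (8, n - 5), (2, 31), (12, n - 3), (30, 34)}" "q \<in> {(3, n - 1), (8, n - 5), (2, 31), (12, n - 3), (30, 34)}"
      "x = fst p \<or> x = snd p" "x = fst q \<or> x = snd q" for p q
      using that by metis
    have eq: "e = f" if "e \<in> edge_cut (nbr_graph n (nb n)) {..<31}" "f \<in> edge_cut (nbr_graph n (nb n)) {..<31}" "x \<in> e" "x \<in> f" for e f
    proof -
      have ef: "e \<in> ?X" "f \<in> ?X" using subsetD[OF crossing_edges that(1)] subsetD[OF crossing_edges that(2)] .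
      obtain p where p: "e = (\<lambda>(x, y). {x, y}) p" "p \<in> {(3, n - 1), (8, n - 5), (2, 31), (12, n - 3), (30, 34)}"
        using ef(1) by (rule imageE)
      obtain q where q: "f = (\<lambda>(x, y). {x, y}) q" "q \<in> {(3, n - 1), (8, n - 5), (2, 31), (12, n - 3), (30, 34)}"
        using ef(2) by (rule imageE)
      have "p = q" by (rule pq[OF p(2) q(2)]) (use that(3,4) p(1) q(1) in \<open>simp_all add: split_beta\<close>)
      then show ?thesis using p(1) q(1) by simp
    qed
    have "finite {e \<in> edge_cut (nbr_graph n (nb n)) {..<31}. x \<in> e}"
      using finite_cut[OF simple_graph_finite_edges[OF nbr_graph_simple[OF nbr_lists_nb]]] by simp
    from card_le_Suc0_iff_eq[OF this] show ?thesis using eq unfolding One_nat_def by blast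
  qed
  show "3 \<le> card (edge_cut (nbr_graph n (nb n)) {x})" if "x \<in> {..<n}" for x
  proof -
    have x: "x < n" using that by simp
    have "card (Pair x ` set (nb n x)) = 3"
      using distinct_card[OF nbr_listsD(2)[OF nbr_lists_nb x]] nbr_listsD(1)[OF nbr_lists_nb x]
      by (simp add: card_image inj_on_def)
    moreover have "card (Pair x ` set (nb n x)) \<le> card (edge_cut (nbr_graph n (nb n)) {x})"
    proof (rule nbr_graph_cut_ge[OF nbr_lists_nb])
      fix a b assume "(a, b) \<in> Pair x ` set (nb n x)"
      then have "a = x" "b \<in> set (nb n x)" by auto
      then show "a \<in> {x} \<and> b \<in> set (nb n a) \<and> b \<notin> {x}" using nbr_listsD(4)[OF nbr_lists_nb x] by auto
    qed (use x in simp)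
    ultimately show ?thesis by simp
  qed
  show "4 \<le> card (edge_cut (nbr_graph n (nb n)) C)" if "C \<subseteq> {..<31}" "2 \<le> card C" for C
    using windmill_cut that .
  show "4 \<le> card (edge_cut (nbr_graph n (nb n)) C)" if "C \<subseteq> {31..<n}" "2 \<le> card C" for C
    using strip_cut that .
qed

end

theorem theorem8p10:
  fixes n :: nat
  assumes "even n" and "n \<ge> 42"
  shows "\<exists>(V :: nat set) (E :: nat set set).
           nontrivial_snark V E \<and> card V = n \<and> perfect_matching_index V E \<ge> 5"
proof (intro exI conjI)
  let ?V = "{..<n}" and ?E = "nbr_graph n (nb n)"
  note nbl = nbr_lists_nb[OF assms]
  note sg = nbr_graph_simple[OF nbl] and cb = nbr_graph_cubic[OF nbl] and es = essentially_4_edge_connected_nb[OF assms]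
    and nc = not_four_coverable[OF assms]
  have "two_connected ?V ?E" by (rule essentially_4_edge_connected_two_connected[OF sg cb es]) (use assms in simp)
  moreover have "\<not> (\<exists>c. proper_edge_colouring 3 ?E c)"
    using four_coverable_if_3_edge_colourable[OF cb] nc by blast
  ultimately show "nontrivial_snark ?V ?E"
    unfolding nontrivial_snark_def snark_def
    by (intro conjI sg cb essentially_4_edge_connected_cyclically_edge_connected[OF sg es] girth_nb[OF assms])
  \<comment> \<open>The first path edge of the strip shows that the empty family of matchings is no
    cover.\<close>
  have "{31, 32} \<in> ?E" unfolding nbr_graph_edge_iff[OF nbl] using assms(2) by (simp add: nb_def)
  then have "?E \<noteq> {}" by blast
  then show "5 \<le> perfect_matching_index ?V ?E" by (rule perfect_matching_index_ge_5[OF nc])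
qed simp

end
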